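(* Let $n\ge 2$ be an integer and let $Q$ be a compact subset of $(0,\infty)\setminus\{2k : k\in\mathbb{N}\}$, where $\mathbb{N}=\{1,2,3,\dots\}$. Then there exists an $n$-dimensional real Banach space $X$ which is not a Hilbert space (that is, its norm is not induced by an inner product) such that, for every $q\in Q$, $X$ is isometric to a subspace of $L_q=L_q([0,1])$.
   Context: For $q>0$, $L_q=L_q([0,1])$ is the space of (classes of) real measurable functions $f$ on $[0,1]$ (Lebesgue measure) with $\|f\|_q=\left(\int_0^1|f(t)|^q\,dt\right)^{1/q}<\infty$ (for $q<1$ this is only a quasi-norm). A normed space $(X,\|\cdot\|)$ is isometric to a subspace of $L_q$ if there is a linear map $T:X\to L_q$ with $\|Tx\|_q=\|x\|$ for all $x\in X$. *)

theory Defs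
  imports "HOL-Analysis.Analysis"
begin

definition is_norm :: "('a::real_vector \<Rightarrow> real) \<Rightarrow> bool"
  where "is_norm N \<longleftrightarrow>
    (\<forall>x. 0 \<le> N x) \<and> (\<forall>x. N x = 0 \<longleftrightarrow> x = 0) \<and>
    (\<forall>c x. N (c *\<^sub>R x) = \<bar>c\<bar> * N x) \<and> (\<forall>x y. N (x + y) \<le> N x + N y)"

definition is_banach_norm :: "('a::real_vector \<Rightarrow> real) \<Rightarrow> bool"
  where "is_banach_norm N \<longleftrightarrow>
    is_norm N \<and> Metric_space.mcomplete UNIV (\<lambda>x y. N (x - y))"

definition is_inner_product :: "('a::real_vector \<Rightarrow> 'a \<Rightarrow> real) \<Rightarrow> bool"
  where "is_inner_product B \<longleftrightarrow>
    bilinear B \<and> (\<forall>x y. B x y = B y x) \<and> (\<forall>x. x \<noteq> 0 \<longrightarrow> 0 < B x x)"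

definition is_hilbert_norm :: "('a::real_vector \<Rightarrow> real) \<Rightarrow> bool"
  where "is_hilbert_norm N \<longleftrightarrow>
    (\<exists>B. is_inner_product B \<and> (\<forall>x. N x = sqrt (B x x)))"

abbreviation unit_leb :: "real measure"
  where "unit_leb \<equiv> lebesgue_on {0..1}"

text \<open>
  Classes modulo almost everywhere equality of Lebesgue measurable real functions on the unit
  interval. Representatives are total functions on the reals; their values outside the unit
  interval play no role.
\<close>

definition ae_eq :: "(real \<Rightarrow> real) \<Rightarrow> (real \<Rightarrow> real) \<Rightarrow> bool"
  where "ae_eq f g \<longleftrightarrow> f \<in> borel_measurable unit_leb \<and> g \<in> borel_measurable unit_leb \<and>
    (AE t in unit_leb. f t = g t)"

lemma part_equivp_ae_eq: "part_equivp ae_eq"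
proof (rule part_equivpI)
  show "\<exists>f. ae_eq f f"
    by (rule exI[of _ "\<lambda>_. 0"]) (simp add: ae_eq_def)
  show "symp ae_eq"
    by (rule sympI) (auto simp: ae_eq_def elim: AE_mp)
  show "transp ae_eq"
  proof (rule transpI)
    fix f g h assume "ae_eq f g" "ae_eq g h"
    then show "ae_eq f h"
      unfolding ae_eq_def by (auto elim: AE_mp)
  qed
qed

quotient_type mfun = "real \<Rightarrow> real" / partial: ae_eq
  by (rule part_equivp_ae_eq)

instantiation mfun :: real_vector
begin

lift_definition zero_mfun :: mfun is "\<lambda>_. 0"
  by (simp add: ae_eq_def)

lift_definition plus_mfun :: "mfun \<Rightarrow> mfun \<Rightarrow> mfun" is "\<lambda>f g t. f t + g t"
  unfolding ae_eq_def by (auto elim: AE_mp)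

lift_definition minus_mfun :: "mfun \<Rightarrow> mfun \<Rightarrow> mfun" is "\<lambda>f g t. f t - g t"
  unfolding ae_eq_def by (auto elim: AE_mp)

lift_definition uminus_mfun :: "mfun \<Rightarrow> mfun" is "\<lambda>f t. - f t"
  unfolding ae_eq_def by (auto elim: AE_mp)

lift_definition scaleR_mfun :: "real \<Rightarrow> mfun \<Rightarrow> mfun" is "\<lambda>c f t. c * f t"
  unfolding ae_eq_def by (auto elim: AE_mp)

instance
  by standard (transfer; auto simp: ae_eq_def algebra_simps)+

end

text \<open>
  For real \<open>x\<close> and \<open>q > 0\<close>, the term \<open>\<bar>x\<bar> powr q\<close> is the usual power, also at \<open>x = 0\<close>.
\<close>

lift_definition in_Lq :: "real \<Rightarrow> mfun \<Rightarrow> bool"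
  is "\<lambda>q f. integrable unit_leb (\<lambda>t. \<bar>f t\<bar> powr q)"
  unfolding ae_eq_def
  by (intro integrable_cong_AE) (auto elim: AE_mp)

lift_definition Lq_norm :: "real \<Rightarrow> mfun \<Rightarrow> real"
  is "\<lambda>q f. (\<integral>t. \<bar>f t\<bar> powr q \<partial>unit_leb) powr (1 / q)"
  unfolding ae_eq_def
  by (intro arg_cong[where f = "\<lambda>y. y powr (1 / _)"] integral_cong_AE) (auto elim: AE_mp)

definition isometric_to_subspace_Lq :: "('a::real_vector \<Rightarrow> real) \<Rightarrow> real \<Rightarrow> bool"
  where "isometric_to_subspace_Lq N q \<longleftrightarrow>
    (\<exists>T :: 'a \<Rightarrow> mfun. linear T \<and> (\<forall>x. in_Lq q (T x)) \<and> (\<forall>x. Lq_norm q (T x) = N x))"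

end

theory Submission
  imports
    Defs
    "HOL-Probability.Weak_Convergence"
    "HOL-Probability.Sinc_Integral"
    "HOL-Complex_Analysis.Cauchy_Integral_Formula"
begin

text \<open>
  Fix a unit vector \<open>e\<close> and put \<open>t = (x \<bullet> e)\<^sup>2 / |x|\<^sup>2\<close>. The norm is \<open>N x = |x| sqrt (1 + \<epsilon> t\<^sup>2)\<close> with a small \<open>\<epsilon> > 0\<close>,
  so that \<open>N x ^ q = |x| ^ q (\<Sum>k. (q/2 gchoose k) \<epsilon> ^ k t ^ (2 k))\<close>.

  Let \<open>w\<close> be the rotation invariant weight \<open>(1 + |\<xi>|\<^sup>2) ^ (- M)\<close>. By rotation invariance
  \<open>\<integral> |x \<bullet> \<xi>| ^ q w(\<xi>) d\<xi> = c |x| ^ q\<close>. Stretching \<open>\<xi>\<close> by \<open>sqrt (1 + s)\<close> in direction \<open>e\<close> turns the right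
  hand side into \<open>c (|x|\<^sup>2 + s (x \<bullet> e)\<^sup>2) ^ (q/2)\<close> and multiplies \<open>w\<close> by a bounded function of \<open>\<xi>\<close> that is
  analytic in \<open>s\<close>. Comparing coefficients of \<open>s ^ j\<close> gives functions \<open>D\<^sub>j\<close>, bounded by \<open>B ^ j\<close>, with
  \<open>\<integral> |x \<bullet> \<xi>| ^ q w D\<^sub>j d\<xi> = c (q/2 gchoose j) |x| ^ q t ^ j\<close>. As \<open>q/2\<close> is not a natural number, the
  coefficient does not vanish, and \<open>N ^ q\<close> is represented by the density
  \<open>w (\<Sum>k. \<epsilon> ^ k (q/2 gchoose k) / (q/2 gchoose 2 k) D\<^bsub>2k\<^esub>)\<close>. Compactness of \<open>Q\<close> makes the quotients of
  binomial coefficients at most \<open>\<delta> ^ (- k)\<close> uniformly in \<open>q\<close>, so one small \<open>\<epsilon>\<close> makes all these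
  densities positive. Such a density is the law of a random vector on the unit interval, which gives
  the embedding. Adding the exponent 1 to \<open>Q\<close> yields the triangle inequality for free.
\<close>

subsection \<open>Rotation invariance of Lebesgue measure\<close>

lemma nn_integral_lborel_shift:
  fixes h :: "'a::euclidean_space \<Rightarrow> ennreal"
  assumes [measurable]: "h \<in> borel_measurable borel"
  shows "(\<integral>\<^sup>+x. h (x + c) \<partial>lborel) = (\<integral>\<^sup>+x. h x \<partial>lborel)"
proof -
  have "(\<integral>\<^sup>+x. h x \<partial>lborel) = (\<integral>\<^sup>+x. h x \<partial>distr lborel borel ((+) c))"
    by (simp add: lborel_distr_plus)
  also have "\<dots> = (\<integral>\<^sup>+x. h (c + x) \<partial>lborel)"
    by (subst nn_integral_distr) auto
  finally show ?thesis by (simp add: add.commute)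
qed

text \<open>
  The change of variables theorem of the library requires a well-ordered index type. Here Fubini,
  translation invariance and the invariance of the unit ball under the map suffice.
\<close>

lemma distr_lborel_orthogonal_transformation:
  fixes f :: "'a::euclidean_space \<Rightarrow> 'a"
  assumes f: "orthogonal_transformation f"
  shows "distr lborel borel f = lborel"
proof (rule measure_eqI)
  obtain f' where f': "\<And>x. f (f' x) = x"
    using orthogonal_transformation_surj[OF f] by (metis surj_def)
  have lin: "linear f" using f by (rule orthogonal_transformation_linear)
  then have [measurable]: "f \<in> borel_measurable borel"
    by (intro borel_measurable_continuous_onI linear_continuous_on) (simp add: linear_conv_bounded_linear)
  fix A assume "A \<in> sets (distr lborel borel f)"
  then have A [measurable]: "A \<in> sets borel" by simp
  let ?B = "ball (0::'a) 1"
  have [measurable]: "?B \<in> sets borel" by simp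
  \<comment> \<open>The ball has positive finite volume, so multiplying by it loses nothing and
    gives a double integral. Shifting \<open>x\<close> by \<open>f' y\<close> and then
    \<open>y\<close> by \<open>- f x\<close> turns the condition \<open>f x \<in> A\<close> into
    \<open>y \<in> A\<close>. For fixed \<open>y\<close>, the points \<open>x\<close> with
    \<open>y - f x\<close> in the ball form a unit ball around \<open>f' y\<close>, because
    \<open>f\<close> is an isometry.\<close>
  have "emeasure (distr lborel borel f) A * emeasure lborel ?B
      = (\<integral>\<^sup>+x. indicator A (f x) \<partial>lborel) * (\<integral>\<^sup>+y. indicator ?B y \<partial>lborel)"
    by (simp add: nn_integral_distr flip: nn_integral_indicator)
  also have "\<dots> = (\<integral>\<^sup>+y. (\<integral>\<^sup>+x. indicator A (f x) * indicator ?B y \<partial>lborel) \<partial>lborel)"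
    using nn_integral_cmult_indicator[of ?B lborel] by (simp add: nn_integral_multc)
  also have "\<dots> = (\<integral>\<^sup>+y. (\<integral>\<^sup>+x. indicator A (f x + y) * indicator ?B y \<partial>lborel) \<partial>lborel)"
  proof (rule nn_integral_cong)
    fix y :: 'a
    have "(\<integral>\<^sup>+x. indicator A (f (x + f' y)) * indicator ?B y \<partial>lborel)
        = (\<integral>\<^sup>+x. indicator A (f x) * indicator ?B y \<partial>lborel)"
      by (rule nn_integral_lborel_shift) measurable
    then show "(\<integral>\<^sup>+x. indicator A (f x) * indicator ?B y \<partial>lborel)
        = (\<integral>\<^sup>+x. indicator A (f x + y) * indicator ?B y \<partial>lborel)"
      by (simp add: linear_add[OF lin] f')
  qed
  also have "\<dots> = (\<integral>\<^sup>+x. (\<integral>\<^sup>+y. indicator A (f x + y) * indicator ?B y \<partial>lborel) \<partial>lborel)"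
    by (rule lborel_pair.Fubini'[symmetric]) measurable
  also have "\<dots> = (\<integral>\<^sup>+x. (\<integral>\<^sup>+y. indicator A y * indicator ?B (y - f x) \<partial>lborel) \<partial>lborel)"
  proof (rule nn_integral_cong)
    fix x :: 'a
    have "(\<integral>\<^sup>+y. indicator A (y + f x) * indicator ?B (y + f x - f x) \<partial>lborel)
        = (\<integral>\<^sup>+y. indicator A y * indicator ?B (y - f x) \<partial>lborel)"
      by (rule nn_integral_lborel_shift) measurable
    then show "(\<integral>\<^sup>+y. indicator A (f x + y) * indicator ?B y \<partial>lborel)
        = (\<integral>\<^sup>+y. indicator A y * indicator ?B (y - f x) \<partial>lborel)"
      by (simp add: add.commute)
  qed
  also have "\<dots> = (\<integral>\<^sup>+y. (\<integral>\<^sup>+x. indicator A y * indicator ?B (y - f x) \<partial>lborel) \<partial>lborel)"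
    by (subst lborel_pair.Fubini') auto
  also have "\<dots> = (\<integral>\<^sup>+y. indicator A y * emeasure lborel ?B \<partial>lborel)"
  proof (rule nn_integral_cong)
    fix y :: 'a
    have "norm (y - f x) = norm (x + (- f' y))" for x
    proof -
      have "y - f x = f (f' y - x)" by (simp add: linear_diff[OF lin] f')
      then show ?thesis
        by (metis f norm_minus_commute orthogonal_transformation_norm uminus_add_conv_diff add.commute)
    qed
    then have "indicator ?B (y - f x) = (indicator ?B (x + (- f' y)) :: ennreal)" for x
      by (simp add: indicator_def)
    then have "(\<integral>\<^sup>+x. indicator ?B (y - f x) \<partial>lborel)
        = (\<integral>\<^sup>+x. indicator ?B (x + (- f' y)) \<partial>lborel)"
      by simp
    also have "\<dots> = emeasure lborel ?B"
      by (subst nn_integral_lborel_shift) auto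
    finally show "(\<integral>\<^sup>+x. indicator A y * indicator ?B (y - f x) \<partial>lborel)
        = indicator A y * emeasure lborel ?B"
      by (subst nn_integral_cmult) auto
  qed
  also have "\<dots> = emeasure lborel A * emeasure lborel ?B"
    by (subst nn_integral_multc) auto
  finally have eq: "emeasure (distr lborel borel f) A * emeasure lborel ?B
      = emeasure lborel A * emeasure lborel ?B" .
  have "emeasure lborel ?B \<noteq> 0"
    using content_ball_pos[of 1 "0::'a"] by (auto simp: measure_def)
  moreover have "emeasure lborel ?B \<noteq> \<infinity>"
    using emeasure_bounded_finite[of ?B] by auto
  ultimately show "emeasure (distr lborel borel f) A = emeasure lborel A"
    using eq by (metis infinity_ennreal_def mult_divide_eq_ennreal)
qed simp

subsection \<open>Borel probability measures as laws on the unit interval\<close>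

text \<open>After scaling by \<open>4 ^ Suc m\<close>, the earlier digits contribute a multiple of
  4, the digit \<open>b m\<close> contributes 0 or 1, and the tail at most 1/3. The floor drops the
  tail, and its parity is the digit.\<close>

lemma base4_digits:
  fixes b :: "nat \<Rightarrow> bool"
  shows "odd \<lfloor>4 ^ Suc m * (\<Sum>j. of_bool (b j) / 4 ^ Suc j :: real)\<rfloor> \<longleftrightarrow> b m"
proof -
  let ?t = "\<lambda>j. of_bool (b j) / 4 ^ Suc j :: real"
  have g: "(\<lambda>j. 1 / 4 ^ Suc (j + k) :: real) sums (1 / 3 / 4 ^ k)" for k
  proof -
    have "(\<lambda>j. 1 / 4 ^ Suc k * (1/4)^j :: real) sums (1 / 4 ^ Suc k * (1 / (1 - 1/4)))"
      by (intro sums_mult geometric_sums) simp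
    then show ?thesis by (simp add: power_add power_divide field_simps)
  qed
  have s: "summable ?t"
    by (rule summable_comparison_test[OF _ sums_summable[OF g[of 0]]]) (auto intro!: exI[of _ 0])
  have s': "summable (\<lambda>j. ?t (j + Suc m))"
    using s by (rule summable_ignore_initial_segment)
  have split: "(\<Sum>j. ?t j) = (\<Sum>j. ?t (j + Suc m)) + (\<Sum>j<Suc m. ?t j)"
    by (rule suminf_split_initial_segment[OF s])
  have t0: "0 \<le> (\<Sum>j. ?t (j + Suc m))"
    by (rule suminf_nonneg[OF s']) simp
  have "(\<Sum>j. ?t (j + Suc m)) \<le> (\<Sum>j. 1 / 4 ^ Suc (j + Suc m))"
    by (rule suminf_le[OF _ s' sums_summable[OF g]]) (auto simp: divide_simps)
  also have "\<dots> = 1 / 3 / 4 ^ Suc m"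
    using g by (rule sums_unique[symmetric])
  finally have t1: "4 ^ Suc m * (\<Sum>j. ?t (j + Suc m)) < 1"
    by (simp add: field_simps)
  define z :: int where "z = (\<Sum>j<m. of_bool (b j) * 4 ^ (m - j))"
  have "4 ^ Suc m * (\<Sum>j<Suc m. ?t j) = (\<Sum>j<m. of_bool (b j) * 4 ^ (m - j)) + of_bool (b m)"
    by (simp add: distrib_left sum_distrib_left power_diff field_simps)
  then have "4 ^ Suc m * (\<Sum>j. ?t j) = of_int (z + of_bool (b m)) + 4 ^ Suc m * (\<Sum>j. ?t (j + Suc m))"
    unfolding split by (simp add: distrib_left z_def)
  then have "\<lfloor>4 ^ Suc m * (\<Sum>j. ?t j)\<rfloor> = z + of_bool (b m)"
    using t0 t1 by (intro floor_unique) auto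
  moreover have "even z" unfolding z_def by (intro dvd_sum) auto
  ultimately show ?thesis by (auto)
qed

text \<open>Recovers a real number from the set of rationals above it. In \<open>ereal\<close> an
  index whose rational is not above \<open>x\<close> can contribute \<open>\<infinity>\<close>,
  which is neutral for the infimum.\<close>

lemma INF_rat_gt:
  fixes x :: real
  shows "(INF k::nat. if x < of_rat (from_nat k) then ereal (of_rat (from_nat k)) else \<infinity>) = ereal x"
proof (rule antisym)
  show "(INF k::nat. if x < of_rat (from_nat k) then ereal (of_rat (from_nat k)) else \<infinity>) \<le> ereal x"
  proof (rule ereal_le_epsilon2)
    fix e :: real assume "0 < e"
    then obtain r where r: "x < of_rat r" "of_rat r < x + e"
      using of_rat_dense[of x "x + e"] by auto
    have "(INF k::nat. if x < of_rat (from_nat k) then ereal (of_rat (from_nat k)) else \<infinity>)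
        \<le> (if x < of_rat (from_nat (to_nat r)) then ereal (of_rat (from_nat (to_nat r))) else \<infinity>)"
      by (rule INF_lower) simp
    also have "\<dots> \<le> ereal x + ereal e" using r by simp
    finally show "(INF k::nat. if x < of_rat (from_nat k) then ereal (of_rat (from_nat k)) else \<infinity>)
        \<le> ereal x + ereal e" .
  qed
qed (rule INF_greatest, simp)

text \<open>
  The digits in base 4 of the image encode, for each coordinate, which rationals exceed it. Only the
  digits 0 and 1 occur, so there are no ambiguous expansions.
\<close>

lemma ex_borel_embedding_real:
  obtains \<psi> :: "'a::euclidean_space \<Rightarrow> real" and \<rho> :: "real \<Rightarrow> 'a"
  where "\<psi> \<in> borel_measurable borel" "\<rho> \<in> borel_measurable borel" "\<And>x. \<rho> (\<psi> x) = x"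
proof
  let ?r = "\<lambda>k. of_rat (from_nat k) :: real"
  let ?b = "from_nat_into (Basis :: 'a set)"
  define bit where "bit x m \<longleftrightarrow> x \<bullet> ?b (fst (prod_decode m)) < ?r (snd (prod_decode m))" for x m
  define \<psi> where "\<psi> x = (\<Sum>m. of_bool (bit x m) / 4 ^ Suc m :: real)" for x
  \<comment> \<open>Off the range of \<open>\<psi>\<close> the infimum may be infinite;
    \<open>real_of_ereal\<close> then returns 0, so \<open>\<rho>\<close> is total and still
    Borel.\<close>
  define \<rho> where "\<rho> y = (\<Sum>b\<in>(Basis :: 'a set). real_of_ereal (INF k. if odd \<lfloor>4 ^ Suc (prod_encode (to_nat_on Basis b, k)) * y\<rfloor>
    then ereal (?r k) else \<infinity>) *\<^sub>R b)" for y :: real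
  have [measurable]: "Measurable.pred borel (\<lambda>x. bit x m)" for m
    unfolding bit_def by measurable
  show "\<psi> \<in> borel_measurable borel"
    unfolding \<psi>_def of_bool_def by measurable
  show "\<rho> \<in> borel_measurable borel"
    unfolding \<rho>_def by measurable
  fix x
  have "odd \<lfloor>4 ^ Suc m * \<psi> x\<rfloor> \<longleftrightarrow> bit x m" for m
    unfolding \<psi>_def by (rule base4_digits)
  then have "\<rho> (\<psi> x) = (\<Sum>b\<in>Basis. real_of_ereal (INF k. if x \<bullet> b < ?r k then ereal (?r k) else \<infinity>) *\<^sub>R b)"
    unfolding \<rho>_def by (intro sum.cong refl) (simp add: bit_def countable_finite)
  also have "\<dots> = x" by (simp only: INF_rat_gt real_of_ereal.simps euclidean_representation)
  finally show "\<rho> (\<psi> x) = x" .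
qed

text \<open>Inverse transform sampling: the generalised inverse \<open>I\<close> of the distribution
  function sends the uniform law on the open unit interval to \<open>P\<close>. Extending it by 0 is
  harmless, as the endpoints are null.\<close>

lemma ex_distr_unit_leb_real:
  assumes "real_distribution P"
  obtains V where "V \<in> borel_measurable borel" "distr unit_leb borel V = P"
proof
  interpret cdf_distribution P
    using assms by (simp add: cdf_distribution_def)
  define V where "V t = (if t \<in> {0<..<1} then I t else 0)" for t
  show V [measurable]: "V \<in> borel_measurable borel"
    unfolding V_def using measurable_CI
    by (subst measurable_If_restrict_space_iff) (simp_all add: greaterThanLessThan_eq Int_def)
  show "distr unit_leb borel V = P"
  proof (rule measure_eqI)
    show "sets (distr unit_leb borel V) = sets P" by simp
    have VL: "V \<in> borel_measurable unit_leb"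
      by (rule measurable_restrict_space1) (rule measurable_completion, simp)
    fix A assume "A \<in> sets (distr unit_leb borel V)"
    then have [measurable]: "A \<in> sets borel" by simp
    have "emeasure (distr unit_leb borel V) A = emeasure lebesgue (V -` A \<inter> {0..1})"
      using VL by (subst emeasure_distr) (auto simp: emeasure_restrict_space space_restrict_space)
    also have "\<dots> = emeasure lborel (V -` A \<inter> {0..1})"
      using measurable_sets[OF V, of A] by simp
    also have "\<dots> = emeasure lborel (V -` A \<inter> {0<..<1})"
      using AE_lborel_singleton[of "0::real"] AE_lborel_singleton[of "1::real"] measurable_sets[OF V, of A]
      by (intro emeasure_eq_AE) (auto elim!: eventually_rev_mp)
    also have "V -` A \<inter> {0<..<1} = I -` A \<inter> {0<..<1}" by (auto simp: V_def)
    also have "emeasure lborel \<dots> = emeasure (distr (restrict_space lborel {0<..<1}) borel I) A"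
      by (subst emeasure_distr) (auto simp: emeasure_restrict_space space_restrict_space)
    also have "\<dots> = emeasure P A" by (simp add: distr_I_eq_M)
    finally show "emeasure (distr unit_leb borel V) A = emeasure P A" .
  qed
qed

text \<open>The embedding \<open>\<psi>\<close> carries \<open>P\<close> to a law on the real line,
  which is realised there; composing with the left inverse \<open>\<rho>\<close> brings it
  back.\<close>

lemma ex_distr_unit_leb:
  fixes P :: "'a::euclidean_space measure"
  assumes "prob_space P" and P: "sets P = sets borel"
  obtains V where "V \<in> borel_measurable borel" "distr unit_leb borel V = P"
proof -
  interpret prob_space P by fact
  obtain \<psi> :: "'a \<Rightarrow> real" and \<rho> where [measurable]: "\<psi> \<in> borel_measurable borel" "\<rho> \<in> borel_measurable borel"
    and inv: "\<And>x. \<rho> (\<psi> x) = x"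
    using ex_borel_embedding_real by blast
  have \<psi>P [measurable]: "\<psi> \<in> borel_measurable P"
    using \<open>\<psi> \<in> borel_measurable borel\<close> by (simp cong: measurable_cong_sets add: P)
  have "real_distribution (distr P borel \<psi>)"
    by (rule real_distribution_distr) measurable
  then obtain U where [measurable]: "U \<in> borel_measurable borel" and U: "distr unit_leb borel U = distr P borel \<psi>"
    by (rule ex_distr_unit_leb_real)
  have UL [measurable]: "U \<in> borel_measurable unit_leb"
    by (rule measurable_restrict_space1) (rule measurable_completion, simp)
  show thesis
  proof
    show "(\<lambda>t. \<rho> (U t)) \<in> borel_measurable borel" by measurable
    have "distr unit_leb borel (\<lambda>t. \<rho> (U t)) = distr (distr unit_leb borel U) borel \<rho>"
      by (subst distr_distr) (auto simp: comp_def)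
    also have "\<dots> = distr P borel (\<lambda>x. \<rho> (\<psi> x))"
      unfolding U by (subst distr_distr) (auto simp: comp_def)
    also have "\<dots> = P"
      by (simp add: inv distr_id2 P)
    finally show "distr unit_leb borel (\<lambda>t. \<rho> (U t)) = P" .
  qed
qed

subsection \<open>Power series and binomial coefficients\<close>

text \<open>A power series with a nonzero coefficient of positive index and value 0 at the origin
  has no other zero near it (\<open>powser_0_nonzero\<close>). The difference of the two series
  vanishes on the whole interval.\<close>

lemma powser_unique:
  fixes a b :: "nat \<Rightarrow> real"
  assumes r: "0 < r"
    and a: "\<And>x. \<bar>x\<bar> < r \<Longrightarrow> (\<lambda>n. a n * x ^ n) sums f x"
    and b: "\<And>x. \<bar>x\<bar> < r \<Longrightarrow> (\<lambda>n. b n * x ^ n) sums f x"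
  shows "a n = b n"
proof (rule ccontr)
  assume n: "a n \<noteq> b n"
  have s: "(\<lambda>n. (a n - b n) * x ^ n) sums 0" if "\<bar>x\<bar> < r" for x
    using sums_diff[OF a b, OF that that] by (simp add: left_diff_distrib)
  \<comment> \<open>\<open>powser_0_nonzero\<close> requires a positive index, so the constant terms
    are compared first.\<close>
  have "a 0 - b 0 = 0"
    using s[of 0] r by (simp add: powser_sums_zero_iff)
  with n have "n > 0" by (cases n) auto
  show False
  proof (rule powser_0_nonzero[of r 0 "\<lambda>n. a n - b n" "\<lambda>_. 0" n])
    fix e :: real
    assume "0 < e" "\<And>z::real. z \<in> cball 0 e - {0} \<Longrightarrow> (0::real) \<noteq> 0"
    from this(2)[of e] this(1) show False by simp
  qed (use r s n \<open>n > 0\<close> in auto)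
qed

text \<open>This product form serves twice: bounding the factors from above controls the
  coefficients \<open>pcoeff\<close>, and bounding them from below controls the quotients in
  \<open>gbinomial_double_ratio\<close>.\<close>

lemma abs_gbinomial: "\<bar>(a::real) gchoose j\<bar> = (\<Prod>i<j. \<bar>a - real i\<bar> / (real i + 1))"
proof (induction j)
  case (Suc j)
  have "\<bar>a gchoose Suc j\<bar> = \<bar>a gchoose j\<bar> * (\<bar>a - real j\<bar> / (real j + 1))"
    by (simp add: gbinomial_prod_rev abs_mult)
  with Suc show ?case by simp
qed simp

lemma abs_gbinomial_le: "\<bar>(a::real) gchoose j\<bar> \<le> (\<bar>a\<bar> + 1) ^ j"
proof -
  have "(\<Prod>i<j. \<bar>a - real i\<bar> / (real i + 1)) \<le> (\<Prod>i<j. \<bar>a\<bar> + 1)"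
  proof (intro prod_mono conjI)
    fix i
    have "\<bar>a - real i\<bar> \<le> \<bar>a\<bar> + i" by simp
    also have "\<dots> \<le> (\<bar>a\<bar> + 1) * (real i + 1)" by (simp add: algebra_simps)
    finally show "\<bar>a - real i\<bar> / (real i + 1) \<le> \<bar>a\<bar> + 1" by (simp add: field_simps)
  qed simp
  then show ?thesis by (simp add: abs_gbinomial)
qed

subsection \<open>Moments of a rotation invariant weight\<close>

text \<open>The common majorant for all weighted integrals below. By Tonelli its integral is a power
  of the one-dimensional integral of \<open>1 / (1 + x\<^sup>2)\<close>.\<close>

lemma integrable_prod_inverse_1_plus_square:
  "integrable lborel (\<lambda>x::'a::euclidean_space. \<Prod>b\<in>Basis. 1 / (1 + (x \<bullet> b)\<^sup>2))"
proof (rule integrableI_nonneg)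
  have "integrable lborel (\<lambda>x::real. 1 / (1 + x\<^sup>2))"
    using integrable_inverse_1_plus_square
    by (simp add: set_integrable_def einterval_def inverse_eq_divide)
  then have fin: "(\<integral>\<^sup>+x. ennreal (1 / (1 + x\<^sup>2)) \<partial>(lborel :: real measure)) < \<infinity>"
    by (subst nn_integral_eq_integral) auto
  have "(\<integral>\<^sup>+x. ennreal (\<Prod>b\<in>Basis. 1 / (1 + (x \<bullet> b)\<^sup>2)) \<partial>(lborel :: 'a measure))
      = (\<integral>\<^sup>+x. (\<Prod>b\<in>Basis. ennreal (1 / (1 + (x \<bullet> b)\<^sup>2))) \<partial>(lborel :: 'a measure))"
    by (simp add: prod_ennreal)
  also have "\<dots> = (\<Prod>b\<in>(Basis::'a set). (\<integral>\<^sup>+x. ennreal (1 / (1 + x\<^sup>2)) \<partial>(lborel :: real measure)))"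
    by (rule nn_integral_lborel_prod) auto
  also have "\<dots> < \<infinity>"
    using fin by (simp add: power_less_top_ennreal)
  finally show "(\<integral>\<^sup>+x. ennreal (\<Prod>b\<in>Basis. 1 / (1 + (x \<bullet> b)\<^sup>2)) \<partial>(lborel :: 'a measure)) < \<infinity>" .
qed (auto intro!: prod_nonneg)

text \<open>For large \<open>M\<close>, up to scaling, the density of a multivariate Student
  distribution. Its algebraic decay keeps the quotient of the stretched weight by the original one
  bounded; Gaussian decay would not.\<close>

definition student :: "real \<Rightarrow> 'a::euclidean_space \<Rightarrow> real"
  where "student M \<xi> = (1 + (norm \<xi>)\<^sup>2) powr (- M)"

lemma student_measurable [measurable]: "student M \<in> borel_measurable borel"
  unfolding student_def[abs_def] by measurable

lemma student_pos: "0 < student M \<xi>"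
proof -
  have "0 < 1 + (norm \<xi>)\<^sup>2" by (simp add: add_pos_nonneg)
  then show ?thesis unfolding student_def by simp
qed

text \<open>The weight with exponent \<open>DIM('a)\<close> supplies one factor
  \<open>1 / (1 + (norm \<xi>)\<^sup>2)\<close> for each basis vector.\<close>

lemma student_le:
  fixes \<xi> :: "'a::euclidean_space"
  shows "student DIM('a) \<xi> \<le> (\<Prod>b\<in>Basis. 1 / (1 + (\<xi> \<bullet> b)\<^sup>2))"
proof -
  have pos: "0 < 1 + (norm \<xi>)\<^sup>2" by (simp add: add_pos_nonneg)
  then have "student DIM('a) \<xi> = (\<Prod>b\<in>(Basis::'a set). 1 / (1 + (norm \<xi>)\<^sup>2))"
    unfolding student_def by (simp add: powr_minus powr_realpow power_divide inverse_eq_divide)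
  also have "\<dots> \<le> (\<Prod>b\<in>Basis. 1 / (1 + (\<xi> \<bullet> b)\<^sup>2))"
  proof (intro prod_mono conjI)
    fix b :: 'a assume "b \<in> Basis"
    then have "(\<xi> \<bullet> b)\<^sup>2 \<le> (norm \<xi>)\<^sup>2"
      using Basis_le_norm[of b \<xi>] by (metis abs_le_square_iff abs_norm_cancel)
    then show "1 / (1 + (norm \<xi>)\<^sup>2) \<le> 1 / (1 + (\<xi> \<bullet> b)\<^sup>2)"
      by (intro divide_left_mono mult_pos_pos) (auto simp: add_pos_nonneg)
  qed (use pos in simp)
  finally show ?thesis .
qed

text \<open>By Cauchy-Schwarz the power of the inner product costs an exponent \<open>q / 2\<close>
  of \<open>1 + (norm \<xi>)\<^sup>2\<close>; the condition on \<open>M\<close> leaves at least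
  \<open>DIM('a)\<close> for the decay.\<close>

lemma inner_powr_mult_student_le:
  fixes x \<xi> :: "'a::euclidean_space"
  assumes q: "0 < q" and M: "DIM('a) + q / 2 \<le> M"
  shows "\<bar>x \<bullet> \<xi>\<bar> powr q * student M \<xi> \<le> norm x powr q * (\<Prod>b\<in>Basis. 1 / (1 + (\<xi> \<bullet> b)\<^sup>2))"
proof -
  let ?w = "1 + (norm \<xi>)\<^sup>2"
  have w: "1 \<le> ?w" by simp
  have "\<bar>x \<bullet> \<xi>\<bar> powr q \<le> (norm x * sqrt ?w) powr q"
  proof (rule powr_mono2)
    have "\<bar>x \<bullet> \<xi>\<bar> \<le> norm x * norm \<xi>" by (rule Cauchy_Schwarz_ineq2)
    also have "\<dots> \<le> norm x * sqrt ?w"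
      by (intro mult_left_mono real_le_rsqrt) auto
    finally show "\<bar>x \<bullet> \<xi>\<bar> \<le> norm x * sqrt ?w" .
  qed (use q in auto)
  also have "\<dots> = norm x powr q * ?w powr (q / 2)"
    using w by (simp add: powr_mult powr_powr flip: powr_half_sqrt)
  finally have "\<bar>x \<bullet> \<xi>\<bar> powr q * student M \<xi> \<le> norm x powr q * ?w powr (q / 2) * student M \<xi>"
    by (rule mult_right_mono) (simp add: student_pos less_imp_le)
  also have "\<dots> = norm x powr q * ?w powr (q / 2 - M)"
    using w by (simp add: student_def powr_add[symmetric])
  also have "\<dots> \<le> norm x powr q * student DIM('a) \<xi>"
    unfolding student_def using w M by (intro mult_left_mono powr_mono) auto
  also have "\<dots> \<le> norm x powr q * (\<Prod>b\<in>Basis. 1 / (1 + (\<xi> \<bullet> b)\<^sup>2))"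
    by (intro mult_left_mono student_le) auto
  finally show ?thesis .
qed

lemma integrable_inner_powr_mult_student:
  fixes x :: "'a::euclidean_space" and g :: "'a \<Rightarrow> real"
  assumes q: "0 < q" and M: "DIM('a) + q / 2 \<le> M"
    and [measurable]: "g \<in> borel_measurable borel" and g: "\<And>\<xi>. \<bar>g \<xi>\<bar> \<le> C"
  shows "integrable lborel (\<lambda>\<xi>. \<bar>x \<bullet> \<xi>\<bar> powr q * student M \<xi> * g \<xi>)"
proof (rule Bochner_Integration.integrable_bound)
  show "integrable lborel (\<lambda>\<xi>. norm x powr q * (\<Prod>b\<in>Basis. 1 / (1 + (\<xi> \<bullet> b)\<^sup>2)) * C)"
    by (intro integrable_mult_left integrable_mult_right integrable_prod_inverse_1_plus_square)
  have "norm (\<bar>x \<bullet> \<xi>\<bar> powr q * student M \<xi> * g \<xi>)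
      \<le> norm x powr q * (\<Prod>b\<in>Basis. 1 / (1 + (\<xi> \<bullet> b)\<^sup>2)) * C" for \<xi>
  proof -
    have "norm (\<bar>x \<bullet> \<xi>\<bar> powr q * student M \<xi> * g \<xi>) = \<bar>x \<bullet> \<xi>\<bar> powr q * student M \<xi> * \<bar>g \<xi>\<bar>"
      using student_pos[of M \<xi>] by (simp add: abs_mult)
    also have "\<dots> \<le> norm x powr q * (\<Prod>b\<in>Basis. 1 / (1 + (\<xi> \<bullet> b)\<^sup>2)) * C"
      by (intro mult_mono inner_powr_mult_student_le q M g mult_nonneg_nonneg prod_nonneg) auto
    finally show ?thesis .
  qed
  then show "AE \<xi> in lborel. norm (\<bar>x \<bullet> \<xi>\<bar> powr q * student M \<xi> * g \<xi>)
      \<le> norm (norm x powr q * (\<Prod>b\<in>Basis. 1 / (1 + (\<xi> \<bullet> b)\<^sup>2)) * C)"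
    unfolding real_norm_def by (intro AE_I2) (meson abs_ge_self order_trans)
qed measurable

lemma integrable_student_mult:
  fixes g :: "'a::euclidean_space \<Rightarrow> real"
  assumes M: "real DIM('a) \<le> M" and [measurable]: "g \<in> borel_measurable borel" and g: "\<And>\<xi>. \<bar>g \<xi>\<bar> \<le> C"
  shows "integrable lborel (\<lambda>\<xi>. student M \<xi> * g \<xi>)"
proof (rule Bochner_Integration.integrable_bound)
  show "integrable lborel (\<lambda>\<xi>::'a. (\<Prod>b\<in>Basis. 1 / (1 + (\<xi> \<bullet> b)\<^sup>2)) * C)"
    by (intro integrable_mult_left integrable_prod_inverse_1_plus_square)
  have "norm (student M \<xi> * g \<xi>) \<le> (\<Prod>b\<in>Basis. 1 / (1 + (\<xi> \<bullet> b)\<^sup>2)) * C" for \<xi>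
  proof -
    have "student M \<xi> \<le> student DIM('a) \<xi>"
      unfolding student_def using M by (intro powr_mono) auto
    also note student_le
    finally have "student M \<xi> * \<bar>g \<xi>\<bar> \<le> (\<Prod>b\<in>Basis. 1 / (1 + (\<xi> \<bullet> b)\<^sup>2)) * C"
      by (intro mult_mono g prod_nonneg) auto
    then show ?thesis using student_pos[of M \<xi>] by (simp add: abs_mult)
  qed
  then show "AE \<xi> in lborel. norm (student M \<xi> * g \<xi>) \<le> norm ((\<Prod>b\<in>Basis. 1 / (1 + (\<xi> \<bullet> b)\<^sup>2)) * C)"
    unfolding real_norm_def by (intro AE_I2) (meson abs_ge_self order_trans)
qed measurable

definition student_moment :: "real \<Rightarrow> real \<Rightarrow> 'a::euclidean_space \<Rightarrow> real"
  where "student_moment M q x = (\<integral>\<xi>. \<bar>x \<bullet> \<xi>\<bar> powr q * student M \<xi> \<partial>lborel)"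

text \<open>An orthogonal map takes \<open>x\<close> to \<open>y\<close>; it preserves Lebesgue
  measure, the weight and the inner product.\<close>

lemma student_moment_cong_norm:
  fixes x y :: "real ^ 'n"
  assumes "norm x = norm y"
  shows "student_moment M q x = student_moment M q y"
proof -
  obtain f where f: "orthogonal_transformation f" "f x = y"
    using orthogonal_transformation_exists[OF assms] by blast
  then have [measurable]: "f \<in> borel_measurable borel"
    by (intro borel_measurable_continuous_onI linear_continuous_on)
      (simp add: orthogonal_transformation_linear flip: linear_conv_bounded_linear)
  have "student_moment M q y = (\<integral>\<xi>. \<bar>y \<bullet> \<xi>\<bar> powr q * student M \<xi> \<partial>distr lborel borel f)"
    by (simp add: student_moment_def distr_lborel_orthogonal_transformation f)
  also have "\<dots> = (\<integral>\<xi>. \<bar>y \<bullet> f \<xi>\<bar> powr q * student M (f \<xi>) \<partial>lborel)"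
    by (rule integral_distr) measurable
  also have "\<dots> = student_moment M q x"
    using f by (simp add: student_moment_def student_def orthogonal_transformation_norm
        orthogonal_transformation_def flip: f(2))
  finally show ?thesis by simp
qed

lemma student_moment_eq:
  fixes x e :: "real ^ 'n"
  assumes "norm e = 1"
  shows "student_moment M q x = norm x powr q * student_moment M q e"
proof -
  have "student_moment M q x = student_moment M q (norm x *\<^sub>R e)"
    by (rule student_moment_cong_norm) (simp add: assms)
  also have "\<dots> = norm x powr q * student_moment M q e"
    unfolding student_moment_def
    by (simp add: abs_mult powr_mult mult.assoc)
  finally show ?thesis .
qed

text \<open>If the integral of this nonnegative function were 0, the closed set of
  \<open>\<xi>\<close> orthogonal to \<open>x\<close> would have full measure. It would then be the
  whole space and contain \<open>x\<close>.\<close>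

lemma student_moment_pos:
  fixes x :: "'a::euclidean_space"
  assumes q: "0 < q" and M: "DIM('a) + q / 2 \<le> M" and x: "x \<noteq> 0"
  shows "0 < student_moment M q x"
proof -
  have int: "integrable lborel (\<lambda>\<xi>. \<bar>x \<bullet> \<xi>\<bar> powr q * student M \<xi>)"
    using integrable_inner_powr_mult_student[OF q M, of "\<lambda>_. 1" 1] by simp
  have nn: "AE \<xi> in lborel. 0 \<le> \<bar>x \<bullet> \<xi>\<bar> powr q * student M \<xi>"
    by (simp add: student_pos less_imp_le)
  have "student_moment M q x \<noteq> 0"
  proof
    assume "student_moment M q x = 0"
    then have "AE \<xi> in lborel. \<bar>x \<bullet> \<xi>\<bar> powr q * student M \<xi> = 0"
      using integral_nonneg_eq_0_iff_AE[OF int nn] by (simp add: student_moment_def)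
    then have "AE \<xi> in lebesgue. \<xi> \<in> {\<xi>. x \<bullet> \<xi> = 0}"
    proof (intro AE_completion, eventually_elim)
      case (elim \<xi>)
      then show ?case using student_pos[of M \<xi>] by auto
    qed
    moreover have "closed {\<xi>. x \<bullet> \<xi> = 0}"
      by (intro closed_Collect_eq continuous_intros)
    ultimately have "x \<in> {\<xi>. x \<bullet> \<xi> = 0}"
      by (metis mem_closed_if_AE_lebesgue)
    then show False using x by simp
  qed
  moreover have "0 \<le> student_moment M q x"
    unfolding student_moment_def using nn by (rule integral_nonneg_AE)
  ultimately show ?thesis by simp
qed

section \<open>Stretching the weight along one axis\<close>

lemma integral_lborel_scale_direction:
  fixes e :: "'a::euclidean_space" and h :: "'a \<Rightarrow> real"
  assumes e: "e \<in> Basis" and k: "0 < k" and [measurable]: "h \<in> borel_measurable borel"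
  shows "(\<integral>\<xi>. h \<xi> \<partial>lborel) = k * (\<integral>\<xi>. h (\<xi> + ((k - 1) * (\<xi> \<bullet> e)) *\<^sub>R e) \<partial>lborel)"
proof -
  let ?c = "\<lambda>j. if j = e then k else 1"
  let ?T = "\<lambda>\<xi>. \<xi> + ((k - 1) * (\<xi> \<bullet> e)) *\<^sub>R e"
  have T: "0 + (\<Sum>j\<in>Basis. (?c j * (\<xi> \<bullet> j)) *\<^sub>R j) = ?T \<xi>" for \<xi>
    by (rule euclidean_eqI) (auto simp: inner_add_left inner_Basis e algebra_simps)
  have c: "(\<Prod>j\<in>Basis. \<bar>?c j\<bar>) = k"
  proof -
    have "(\<Prod>j\<in>Basis. \<bar>?c j\<bar>) = (\<Prod>j\<in>Basis. if j = e then k else 1)"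
      using k by (intro prod.cong) auto
    then show ?thesis using e by (simp add: prod.delta)
  qed
  have [measurable]: "?T \<in> borel_measurable borel" by measurable
  have "lborel = density (distr lborel borel ?T) (\<lambda>_. ennreal k)"
    using lborel_affine_euclidean[of ?c 0] k unfolding T c by auto
  then have "(\<integral>\<xi>. h \<xi> \<partial>lborel) = (\<integral>\<xi>. h \<xi> \<partial>density (distr lborel borel ?T) (\<lambda>_. ennreal k))"
    by simp
  also have "\<dots> = (\<integral>\<xi>. k * h \<xi> \<partial>distr lborel borel ?T)"
    using k by (subst integral_density) auto
  also have "\<dots> = (\<integral>\<xi>. k * h (?T \<xi>) \<partial>lborel)"
    by (rule integral_distr) measurable
  finally show ?thesis by simp
qed

text \<open>
  Chosen so that \<open>(1 + |\<xi>|\<^sup>2) (1 + s off_axis e \<xi>)\<close> is \<open>1 + s\<close> times the value of \<open>1 + |\<eta>|\<^sup>2\<close>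
  at the vector \<open>\<eta>\<close> whose stretching by \<open>sqrt (1 + s)\<close> along \<open>e\<close> is \<open>\<xi>\<close>.
\<close>

definition off_axis :: "'a::euclidean_space \<Rightarrow> 'a \<Rightarrow> real"
  where "off_axis e \<xi> = (1 + (norm \<xi>)\<^sup>2 - (\<xi> \<bullet> e)\<^sup>2) / (1 + (norm \<xi>)\<^sup>2)"

lemma off_axis_measurable [measurable]: "off_axis e \<in> borel_measurable borel"
  unfolding off_axis_def[abs_def] by measurable

lemma off_axis_bounds:
  assumes "norm e = 1"
  shows "0 \<le> off_axis e \<xi>" "off_axis e \<xi> \<le> 1"
proof -
  have "\<bar>\<xi> \<bullet> e\<bar> \<le> norm \<xi>"
    using Cauchy_Schwarz_ineq2[of \<xi> e] assms by simp
  then have "(\<xi> \<bullet> e)\<^sup>2 \<le> (norm \<xi>)\<^sup>2"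
    by (metis abs_le_square_iff abs_norm_cancel)
  moreover have "0 < 1 + (norm \<xi>)\<^sup>2" by (simp add: add_pos_nonneg)
  ultimately show "0 \<le> off_axis e \<xi>" "off_axis e \<xi> \<le> 1"
    by (simp_all add: off_axis_def)
qed

text \<open>The integral on the left is the moment at the stretched vector \<open>?T x\<close>,
  whose squared norm is \<open>(norm x)\<^sup>2 + s * (x \<bullet> e)\<^sup>2\<close>. In the
  exponent \<open>M - 1/2\<close>, the \<open>M\<close> comes from the weight and the
  \<open>- 1/2\<close> from the Jacobian \<open>sqrt (1 + s)\<close>.\<close>

lemma student_moment_perturbed:
  fixes x e :: "real ^ 'n"
  assumes e: "e \<in> Basis" and s: "\<bar>s\<bar> < 1"
  shows "(\<integral>\<xi>. \<bar>x \<bullet> \<xi>\<bar> powr q * student M \<xi> * ((1 + s) powr (M - 1/2) * (1 + s * off_axis e \<xi>) powr (- M)) \<partial>lborel)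
    = student_moment M q e * ((norm x)\<^sup>2 + s * (x \<bullet> e)\<^sup>2) powr (q / 2)"
proof -
  let ?k = "sqrt (1 + s)"
  let ?T = "\<lambda>\<xi>. \<xi> + ((?k - 1) * (\<xi> \<bullet> e)) *\<^sub>R e"
  \<comment> \<open>Chosen so that composing with \<open>?T\<close> restores the unperturbed
    weight.\<close>
  let ?h = "\<lambda>\<xi>. \<bar>x \<bullet> \<xi>\<bar> powr q * (1 + (norm \<xi>)\<^sup>2 - (\<xi> \<bullet> e)\<^sup>2 * s / (1 + s)) powr (- M)"
  have k: "0 < ?k" "?k\<^sup>2 = 1 + s" using s by auto
  have ee: "e \<bullet> e = 1" using e by (simp add: inner_same_Basis)
  have normT: "(norm (?T y))\<^sup>2 = (norm y)\<^sup>2 + s * (y \<bullet> e)\<^sup>2" for y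
  proof -
    have "(norm (?T y))\<^sup>2 = (norm y)\<^sup>2 + (?k\<^sup>2 - 1) * (y \<bullet> e)\<^sup>2"
      unfolding power2_norm_eq_inner inner_add_left inner_add_right inner_scaleR_left inner_scaleR_right
        inner_commute[of e y] ee by algebra
    then show ?thesis by (simp only: k) simp
  qed
  have Te: "(?T y \<bullet> e)\<^sup>2 = (1 + s) * (y \<bullet> e)\<^sup>2" for y
  proof -
    have "?T y \<bullet> e = ?k * (y \<bullet> e)" by (simp add: inner_add_left ee algebra_simps)
    then show ?thesis by (simp only: power_mult_distrib k)
  qed
  \<comment> \<open>\<open>?T\<close> is self-adjoint, which moves the stretching from
    \<open>\<xi>\<close> to \<open>x\<close>.\<close>
  have swap: "x \<bullet> ?T \<xi> = ?T x \<bullet> \<xi>" for \<xi>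
    by (simp add: inner_add_left inner_add_right inner_commute[of e \<xi>])
  have hT: "?h (?T \<xi>) = \<bar>?T x \<bullet> \<xi>\<bar> powr q * student M \<xi>" for \<xi>
  proof -
    have "1 + (norm (?T \<xi>))\<^sup>2 - (?T \<xi> \<bullet> e)\<^sup>2 * s / (1 + s) = 1 + (norm \<xi>)\<^sup>2"
      unfolding normT Te using s by (simp add: field_simps)
    then show ?thesis by (simp only: swap student_def)
  qed
  have h: "\<bar>x \<bullet> \<xi>\<bar> powr q * student M \<xi> * ((1 + s) powr (M - 1/2) * (1 + s * off_axis e \<xi>) powr (- M))
      = ?h \<xi> / ?k" for \<xi>
  proof -
    have w: "0 < 1 + (norm \<xi>)\<^sup>2" by (simp add: add_pos_nonneg)
    have v: "0 < 1 + s * off_axis e \<xi>"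
    proof -
      have "\<bar>s * off_axis e \<xi>\<bar> \<le> \<bar>s\<bar> * 1"
        unfolding abs_mult using off_axis_bounds[of e \<xi>] e by (intro mult_left_mono) auto
      then show ?thesis using s by linarith
    qed
    have "1 + (norm \<xi>)\<^sup>2 - (\<xi> \<bullet> e)\<^sup>2 * s / (1 + s)
        = (1 + (norm \<xi>)\<^sup>2) * (1 + s * off_axis e \<xi>) / (1 + s)"
    proof -
      have "(1 + (norm \<xi>)\<^sup>2) * off_axis e \<xi> = 1 + (norm \<xi>)\<^sup>2 - (\<xi> \<bullet> e)\<^sup>2"
        using w by (simp add: off_axis_def)
      then have "(1 + (norm \<xi>)\<^sup>2) * (1 + s * off_axis e \<xi>)
          = 1 + (norm \<xi>)\<^sup>2 + s * (1 + (norm \<xi>)\<^sup>2 - (\<xi> \<bullet> e)\<^sup>2)"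
        by algebra
      then show ?thesis using s by (simp add: field_simps)
    qed
    then have "(1 + (norm \<xi>)\<^sup>2 - (\<xi> \<bullet> e)\<^sup>2 * s / (1 + s)) powr (- M)
        = student M \<xi> * (1 + s * off_axis e \<xi>) powr (- M) * (1 + s) powr M"
      using w v s by (simp add: powr_divide powr_mult student_def powr_minus_divide[of "1 + s"])
    moreover have "(1 + s) powr (M - 1/2) = (1 + s) powr M / ?k"
      using s by (simp add: powr_diff powr_half_sqrt)
    ultimately show ?thesis by simp
  qed
  have "(\<integral>\<xi>. \<bar>x \<bullet> \<xi>\<bar> powr q * student M \<xi> * ((1 + s) powr (M - 1/2) * (1 + s * off_axis e \<xi>) powr (- M)) \<partial>lborel)
      = (\<integral>\<xi>. ?h \<xi> \<partial>lborel) / ?k"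
    unfolding h by simp
  also have "(\<integral>\<xi>. ?h \<xi> \<partial>lborel) = ?k * (\<integral>\<xi>. ?h (?T \<xi>) \<partial>lborel)"
    by (rule integral_lborel_scale_direction[OF e k(1)]) measurable
  also have "(\<integral>\<xi>. ?h (?T \<xi>) \<partial>lborel) = student_moment M q (?T x)"
    unfolding hT student_moment_def ..
  also have "\<dots> = norm (?T x) powr q * student_moment M q e"
    using e by (intro student_moment_eq) simp
  also have "norm (?T x) powr q = ((norm x)\<^sup>2 + s * (x \<bullet> e)\<^sup>2) powr (q / 2)"
  proof (cases "?T x = 0")
    case True
    then have "(norm x)\<^sup>2 + s * (x \<bullet> e)\<^sup>2 = 0" using normT[of x] by simp
    then show ?thesis using True by simp
  next
    case False
    then have "norm (?T x) powr q = ((norm (?T x)) powr 2) powr (q / 2)"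
      by (simp only: powr_powr) simp
    also have "norm (?T x) powr 2 = (norm (?T x))\<^sup>2" using False by (simp add: powr_numeral)
    finally show ?thesis unfolding normT .
  qed
  finally show ?thesis using k(1) by simp
qed

subsection \<open>Expansion in the stretching parameter\<close>

text \<open>Termwise integration in the manner of the Weierstrass M-test: the integrals of
  \<open>norm (W \<xi> * g n \<xi>)\<close> are at most a constant times \<open>C n\<close>.\<close>

lemma sums_integral_mult_bounded:
  fixes W :: "'a \<Rightarrow> real" and g :: "nat \<Rightarrow> 'a \<Rightarrow> real"
  assumes W: "integrable M W" and g [measurable]: "\<And>n. g n \<in> borel_measurable M"
    and le: "\<And>n \<xi>. \<bar>g n \<xi>\<bar> \<le> C n" and C: "summable C"
  shows "(\<lambda>n. \<integral>\<xi>. W \<xi> * g n \<xi> \<partial>M) sums (\<integral>\<xi>. W \<xi> * (\<Sum>n. g n \<xi>) \<partial>M)"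
proof -
  have W' [measurable]: "W \<in> borel_measurable M" using W by simp
  have le': "norm (W \<xi> * g n \<xi>) \<le> \<bar>W \<xi>\<bar> * C n" for n \<xi>
    using le[of n \<xi>] by (simp add: abs_mult mult_left_mono)
  have int: "integrable M (\<lambda>\<xi>. W \<xi> * g n \<xi>)" for n
  proof (rule Bochner_Integration.integrable_bound)
    show "integrable M (\<lambda>\<xi>. \<bar>W \<xi>\<bar> * C n)" using W by simp
    show "AE \<xi> in M. norm (W \<xi> * g n \<xi>) \<le> norm (\<bar>W \<xi>\<bar> * C n)"
      unfolding real_norm_def using le' by (intro AE_I2) (metis abs_ge_self order_trans real_norm_def)
  qed measurable
  have summ: "summable (\<lambda>n. norm (g n \<xi>))" for \<xi>
    by (rule summable_comparison_test[OF _ C]) (use le in auto)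
  have "(\<lambda>n. \<integral>\<xi>. W \<xi> * g n \<xi> \<partial>M) sums (\<integral>\<xi>. (\<Sum>n. W \<xi> * g n \<xi>) \<partial>M)"
  proof (rule sums_integral[OF int])
    show "AE \<xi> in M. summable (\<lambda>n. norm (W \<xi> * g n \<xi>))"
      using summ by (intro AE_I2) (simp add: abs_mult summable_mult)
    show "summable (\<lambda>n. \<integral>\<xi>. norm (W \<xi> * g n \<xi>) \<partial>M)"
    proof (rule summable_comparison_test)
      show "summable (\<lambda>n. (\<integral>\<xi>. \<bar>W \<xi>\<bar> \<partial>M) * C n)" using C by (rule summable_mult)
      have "(\<integral>\<xi>. norm (W \<xi> * g n \<xi>) \<partial>M) \<le> (\<integral>\<xi>. \<bar>W \<xi>\<bar> * C n \<partial>M)" for n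
        using int[of n] W le' by (intro integral_mono) auto
      then show "\<exists>N. \<forall>n\<ge>N. norm (\<integral>\<xi>. norm (W \<xi> * g n \<xi>) \<partial>M) \<le> (\<integral>\<xi>. \<bar>W \<xi>\<bar> \<partial>M) * C n"
        by simp
    qed
  qed
  also have "(\<lambda>\<xi>. \<Sum>n. W \<xi> * g n \<xi>) = (\<lambda>\<xi>. W \<xi> * (\<Sum>n. g n \<xi>))"
    using summable_norm_cancel[OF summ] by (intro ext suminf_mult)
  finally show ?thesis .
qed

text \<open>
  The coefficient of \<open>s ^ j\<close> in \<open>(1 + s) powr (M - 1/2) * (1 + s * v) powr (- M)\<close>.
\<close>

definition pcoeff :: "real \<Rightarrow> nat \<Rightarrow> real \<Rightarrow> real"
  where "pcoeff M j v = (\<Sum>i\<le>j. ((M - 1/2) gchoose i) * ((- M gchoose (j - i)) * v ^ (j - i)))"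

lemma pcoeff_0 [simp]: "pcoeff M 0 v = 1"
  by (simp add: pcoeff_def)

lemma pcoeff_measurable [measurable]: "pcoeff M j \<in> borel_measurable borel"
  unfolding pcoeff_def[abs_def] by measurable

text \<open>Each of the \<open>j + 1\<close> summands is at most \<open>(M + 1) ^ j\<close>, and
  \<open>j + 1 \<le> 2 ^ j\<close>. A purely exponential bound is what the geometric majorants below
  need.\<close>

lemma abs_pcoeff_le:
  assumes M: "1 \<le> M" and v: "0 \<le> v" "v \<le> 1"
  shows "\<bar>pcoeff M j v\<bar> \<le> (2 * (M + 1)) ^ j"
proof -
  have "\<bar>pcoeff M j v\<bar> \<le> (\<Sum>i\<le>j. \<bar>((M - 1/2) gchoose i) * ((- M gchoose (j - i)) * v ^ (j - i))\<bar>)"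
    unfolding pcoeff_def by (rule sum_abs)
  also have "\<dots> \<le> (\<Sum>i\<le>j. (M + 1) ^ j)"
  proof (rule sum_mono)
    fix i assume "i \<in> {..j}"
    then have i: "i \<le> j" by simp
    have "\<bar>(M - 1/2) gchoose i\<bar> \<le> (M + 1) ^ i"
      using abs_gbinomial_le[of "M - 1/2" i] M by (rule_tac order_trans[OF _ power_mono]) auto
    moreover have "\<bar>- M gchoose (j - i)\<bar> \<le> (M + 1) ^ (j - i)"
      using abs_gbinomial_le[of "- M" "j - i"] M by simp
    moreover have "\<bar>v ^ (j - i)\<bar> \<le> 1"
      using v by (simp add: power_le_one)
    ultimately have "\<bar>((M - 1/2) gchoose i) * ((- M gchoose (j - i)) * v ^ (j - i))\<bar>
        \<le> (M + 1) ^ i * ((M + 1) ^ (j - i) * 1)"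
      unfolding abs_mult using M by (intro mult_mono) auto
    also have "\<dots> = (M + 1) ^ j" using i by (simp flip: power_add)
    finally show "\<bar>((M - 1/2) gchoose i) * ((- M gchoose (j - i)) * v ^ (j - i))\<bar> \<le> (M + 1) ^ j" .
  qed
  also have "\<dots> = real (j + 1) * (M + 1) ^ j" by simp
  also have "\<dots> \<le> 2 ^ j * (M + 1) ^ j"
  proof (rule mult_right_mono)
    have "j + 1 \<le> 2 ^ j" using less_exp[of j] by (simp add: Suc_le_eq del: less_exp)
    then show "real (j + 1) \<le> 2 ^ j" by (metis of_nat_le_iff of_nat_numeral of_nat_power)
  qed (use M in simp)
  finally show ?thesis by (simp only: power_mult_distrib)
qed

lemma summable_abs_gbinomial:
  fixes z :: real
  assumes "\<bar>z\<bar> < 1"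
  shows "summable (\<lambda>k. norm ((a gchoose k) * z ^ k))"
proof -
  obtain y where "\<bar>z\<bar> < y" "y < 1" using dense[OF assms] by blast
  then show ?thesis
    using gen_binomial_real[of y a] by (intro powser_insidea[of _ y]) (auto simp: sums_iff)
qed

text \<open>Cauchy product of two binomial series; the second converges because
  \<open>\<bar>s * v\<bar> < 1\<close>.\<close>

lemma pcoeff_sums:
  assumes s: "\<bar>s\<bar> < 1" and v: "0 \<le> v" "v \<le> 1"
  shows "(\<lambda>j. pcoeff M j v * s ^ j) sums ((1 + s) powr (M - 1/2) * (1 + s * v) powr (- M))"
proof -
  have sv: "\<bar>s * v\<bar> < 1"
    using mult_left_mono[of v 1 "\<bar>s\<bar>"] s v by (simp add: abs_mult)
  have "(\<lambda>k. \<Sum>i\<le>k. ((M - 1/2) gchoose i) * s ^ i * ((- M gchoose (k - i)) * (s * v) ^ (k - i)))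
      sums ((\<Sum>k. ((M - 1/2) gchoose k) * s ^ k) * (\<Sum>k. (- M gchoose k) * (s * v) ^ k))"
    by (intro Cauchy_product_sums summable_abs_gbinomial s sv)
  also have "(\<lambda>k. \<Sum>i\<le>k. ((M - 1/2) gchoose i) * s ^ i * ((- M gchoose (k - i)) * (s * v) ^ (k - i)))
      = (\<lambda>k. pcoeff M k v * s ^ k)"
  proof
    fix k
    have "((M - 1/2) gchoose i) * s ^ i * ((- M gchoose (k - i)) * (s * v) ^ (k - i))
      = ((M - 1/2) gchoose i) * ((- M gchoose (k - i)) * v ^ (k - i)) * s ^ k" if "i \<le> k" for i
    proof -
      have "s ^ k = s ^ i * s ^ (k - i)" using that by (simp flip: power_add)
      then show ?thesis by (simp add: power_mult_distrib)
    qed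
    then show "(\<Sum>i\<le>k. ((M - 1/2) gchoose i) * s ^ i * ((- M gchoose (k - i)) * (s * v) ^ (k - i)))
      = pcoeff M k v * s ^ k"
      unfolding pcoeff_def sum_distrib_right by (intro sum.cong) auto
  qed
  also have "(\<Sum>k. ((M - 1/2) gchoose k) * s ^ k) = (1 + s) powr (M - 1/2)"
    using gen_binomial_real[OF s] by (rule sums_unique[symmetric])
  also have "(\<Sum>k. (- M gchoose k) * (s * v) ^ k) = (1 + s * v) powr (- M)"
    using gen_binomial_real[OF sv] by (rule sums_unique[symmetric])
  finally show ?thesis .
qed

lemma axis_ratio_bounds:
  fixes x e :: "'a::euclidean_space"
  assumes "norm e = 1"
  shows "0 \<le> (x \<bullet> e)\<^sup>2 / (norm x)\<^sup>2" "(x \<bullet> e)\<^sup>2 / (norm x)\<^sup>2 \<le> 1"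
proof -
  have "\<bar>x \<bullet> e\<bar> \<le> norm x" using Cauchy_Schwarz_ineq2[of x e] assms by simp
  then have "(x \<bullet> e)\<^sup>2 \<le> (norm x)\<^sup>2" by (metis abs_le_square_iff abs_norm_cancel)
  then show "(x \<bullet> e)\<^sup>2 / (norm x)\<^sup>2 \<le> 1" by (simp add: divide_le_eq)
qed simp

text \<open>Both sides of \<open>student_moment_perturbed\<close> are expanded in \<open>s\<close>:
  the left by termwise integration of \<open>pcoeff_sums\<close>, the right by the binomial series.
  Uniqueness of power series gives the coefficients. At \<open>x = 0\<close> both sides
  vanish.\<close>

lemma moment_pcoeff:
  fixes x e :: "real ^ 'n"
  assumes e: "e \<in> Basis" and q: "0 < q" and M: "CARD('n) + q / 2 \<le> M"
  shows "(\<integral>\<xi>. \<bar>x \<bullet> \<xi>\<bar> powr q * student M \<xi> * pcoeff M j (off_axis e \<xi>) \<partial>lborel)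
    = student_moment M q e * norm x powr q * (((q / 2) gchoose j) * ((x \<bullet> e)\<^sup>2 / (norm x)\<^sup>2) ^ j)"
proof (cases "x = 0")
  case False
  let ?W = "\<lambda>\<xi>. \<bar>x \<bullet> \<xi>\<bar> powr q * student M \<xi>"
  let ?t = "(x \<bullet> e)\<^sup>2 / (norm x)\<^sup>2"
  have "1 \<le> CARD('n)" by (simp add: Suc_leI)
  with M q have M1: "1 \<le> M" by linarith
  have ne: "norm e = 1" using e by simp
  have W: "integrable lborel ?W"
    using integrable_inner_powr_mult_student[of q M "\<lambda>_. 1" 1 x] q M by simp
  \<comment> \<open>Within this radius the bound of \<open>abs_pcoeff_le\<close> gives a convergent
    geometric majorant.\<close>
  let ?r = "1 / (2 * (M + 1))"
  have r: "0 < ?r" "?r < 1" using M1 by (auto simp: divide_simps)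
  show ?thesis
  proof (rule powser_unique[OF r(1)])
    fix s :: real assume s: "\<bar>s\<bar> < ?r"
    then have s1: "\<bar>s\<bar> < 1" using r(2) by linarith
    have "(\<lambda>n. \<integral>\<xi>. ?W \<xi> * (pcoeff M n (off_axis e \<xi>) * s ^ n) \<partial>lborel)
        sums (\<integral>\<xi>. ?W \<xi> * (\<Sum>n. pcoeff M n (off_axis e \<xi>) * s ^ n) \<partial>lborel)"
    proof (rule sums_integral_mult_bounded[OF W])
      show "\<bar>pcoeff M n (off_axis e \<xi>) * s ^ n\<bar> \<le> (2 * (M + 1) * \<bar>s\<bar>) ^ n" for n \<xi>
        using mult_right_mono[OF abs_pcoeff_le[OF M1 off_axis_bounds[OF ne]], of "\<bar>s\<bar> ^ n" n \<xi>]
        by (simp only: abs_mult power_abs power_mult_distrib zero_le_power abs_ge_zero)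
      show "summable (\<lambda>n. (2 * (M + 1) * \<bar>s\<bar>) ^ n)"
        using s M1 by (intro summable_geometric) (simp add: abs_mult field_simps)
    qed measurable
    also have "(\<lambda>\<xi>. \<Sum>n. pcoeff M n (off_axis e \<xi>) * s ^ n)
        = (\<lambda>\<xi>. (1 + s) powr (M - 1/2) * (1 + s * off_axis e \<xi>) powr (- M))"
      using pcoeff_sums[OF s1 off_axis_bounds[OF ne]] by (intro ext sums_unique[symmetric])
    also have "(\<integral>\<xi>. ?W \<xi> * ((1 + s) powr (M - 1/2) * (1 + s * off_axis e \<xi>) powr (- M)) \<partial>lborel)
        = student_moment M q e * ((norm x)\<^sup>2 + s * (x \<bullet> e)\<^sup>2) powr (q / 2)"
      by (rule student_moment_perturbed[OF e s1])
    finally show "(\<lambda>n. (\<integral>\<xi>. ?W \<xi> * pcoeff M n (off_axis e \<xi>) \<partial>lborel) * s ^ n)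
        sums (student_moment M q e * ((norm x)\<^sup>2 + s * (x \<bullet> e)\<^sup>2) powr (q / 2))"
      by (simp flip: mult.assoc)
    have t: "\<bar>s * ?t\<bar> < 1"
      using mult_left_mono[OF axis_ratio_bounds(2)[OF ne, of x], of "\<bar>s\<bar>"] s1 by (simp add: abs_mult)
    have "(norm x)\<^sup>2 + s * (x \<bullet> e)\<^sup>2 = (norm x)\<^sup>2 * (1 + s * ?t)"
      using False by (simp add: field_simps)
    then have "((norm x)\<^sup>2 + s * (x \<bullet> e)\<^sup>2) powr (q / 2) = ((norm x)\<^sup>2) powr (q / 2) * (1 + s * ?t) powr (q / 2)"
      using t by (simp add: powr_mult)
    also have "((norm x)\<^sup>2) powr (q / 2) = norm x powr q"
      using False by (simp add: powr_powr flip: powr_numeral)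
    finally have "((norm x)\<^sup>2 + s * (x \<bullet> e)\<^sup>2) powr (q / 2) = norm x powr q * (1 + s * ?t) powr (q / 2)" .
    moreover have "(\<lambda>n. student_moment M q e * norm x powr q * (((q / 2) gchoose n) * (s * ?t) ^ n))
        sums (student_moment M q e * norm x powr q * (1 + s * ?t) powr (q / 2))"
      by (intro sums_mult gen_binomial_real t)
    ultimately show "(\<lambda>n. student_moment M q e * norm x powr q * (((q / 2) gchoose n) * ?t ^ n) * s ^ n)
        sums (student_moment M q e * ((norm x)\<^sup>2 + s * (x \<bullet> e)\<^sup>2) powr (q / 2))"
      by (simp only: power_mult_distrib mult_ac)
  qed
qed simp

section \<open>A positive density representing the norm\<close>

lemma gbinomial_double_ratio:
  fixes a \<delta> :: real
  assumes \<delta>: "0 < \<delta>" and a: "\<And>j::nat. \<delta> * (real j + 1) \<le> \<bar>a - real j\<bar>"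
  shows "a gchoose k \<noteq> 0" "\<bar>(a gchoose k) / (a gchoose (2 * k))\<bar> \<le> (1 / \<delta>) ^ k"
proof -
  have ge: "\<delta> \<le> \<bar>a - real i\<bar> / (real i + 1)" for i
    using a[of i] by (simp add: le_divide_eq)
  have pos: "0 < \<bar>a gchoose n\<bar>" for n
    unfolding abs_gbinomial using ge \<delta> by (intro prod_pos) (metis less_le_trans)
  then show "a gchoose k \<noteq> 0" by (metis abs_zero less_irrefl)
  \<comment> \<open>Passing from \<open>k\<close> to \<open>2 * k\<close> multiplies the coefficient
    by \<open>k\<close> further factors, each at least \<open>\<delta>\<close> in absolute value.
    Hence the quotient costs at most \<open>1 / \<delta>\<close> per factor.\<close>
  have "\<bar>a gchoose (2 * k)\<bar> = \<bar>a gchoose k\<bar> * (\<Prod>i\<in>{k..<2 * k}. \<bar>a - real i\<bar> / (real i + 1))"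
    using prod.atLeastLessThan_concat[of 0 k "2 * k" "\<lambda>i. \<bar>a - real i\<bar> / (real i + 1)"]
    by (simp add: abs_gbinomial lessThan_atLeast0)
  moreover have "(\<Prod>i\<in>{k..<2 * k}. \<delta>) \<le> (\<Prod>i\<in>{k..<2 * k}. \<bar>a - real i\<bar> / (real i + 1))"
    using ge \<delta> by (intro prod_mono) auto
  ultimately have "\<bar>a gchoose k\<bar> * \<delta> ^ k \<le> \<bar>a gchoose (2 * k)\<bar>"
    by (simp add: mult_left_mono)
  then show "\<bar>(a gchoose k) / (a gchoose (2 * k))\<bar> \<le> (1 / \<delta>) ^ k"
    using pos[of "2 * k"] \<delta> by (simp add: abs_divide power_divide field_simps)
qed

text \<open>
  At \<open>x = 0\<close> the quotient is \<open>0 / 0 = 0\<close>.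
\<close>

definition quartic_norm :: "real \<Rightarrow> 'a::euclidean_space \<Rightarrow> 'a \<Rightarrow> real"
  where "quartic_norm \<epsilon> e x = norm x * sqrt (1 + \<epsilon> * ((x \<bullet> e)\<^sup>2 / (norm x)\<^sup>2)\<^sup>2)"

lemma ex_weight:
  fixes e :: "real ^ 'n"
  assumes e: "e \<in> Basis" and q: "0 < q" and M: "CARD('n) + q / 2 \<le> M"
    and \<delta>: "0 < \<delta>" "\<And>j::nat. \<delta> * (real j + 1) \<le> \<bar>q / 2 - real j\<bar>"
    and \<epsilon>: "0 < \<epsilon>" "\<epsilon> < 1" "\<epsilon> / \<delta> * (2 * (M + 1))\<^sup>2 \<le> 1 / 3"
  obtains h where "h \<in> borel_measurable borel" "\<And>\<xi>. 1 / 2 \<le> h \<xi>" "\<And>\<xi>. h \<xi> \<le> 3 / 2"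
    "\<And>x. (\<integral>\<xi>. \<bar>x \<bullet> \<xi>\<bar> powr q * student M \<xi> * h \<xi> \<partial>lborel) = student_moment M q e * quartic_norm \<epsilon> e x powr q"
proof
  let ?a = "q / 2"
  \<comment> \<open>The quotient trades the coefficient \<open>?a gchoose (2 * k)\<close> produced
    by \<open>moment_pcoeff\<close> for \<open>?a gchoose k\<close>. The moments of the
    \<open>g k\<close> then form the binomial series of
    \<open>(1 + \<epsilon> * ?t\<^sup>2) powr ?a\<close>.\<close>
  define \<rho> where "\<rho> k = (?a gchoose k) / (?a gchoose (2 * k))" for k
  define g where "g k \<xi> = \<epsilon> ^ k * \<rho> k * pcoeff M (2 * k) (off_axis e \<xi>)" for k \<xi>
  have "1 \<le> CARD('n)" by (simp add: Suc_leI)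
  with M q have M1: "1 \<le> M" by linarith
  have ne: "norm e = 1" using e by simp
  have g_meas [measurable]: "g k \<in> borel_measurable borel" for k
    unfolding g_def[abs_def] by measurable
  have g0: "g 0 \<xi> = 1" for \<xi> by (simp add: g_def \<rho>_def)
  have g_le: "\<bar>g k \<xi>\<bar> \<le> (1 / 3) ^ k" for k \<xi>
  proof -
    have "\<bar>g k \<xi>\<bar> \<le> \<epsilon> ^ k * (1 / \<delta>) ^ k * (2 * (M + 1)) ^ (2 * k)"
      unfolding g_def abs_mult
    proof (intro mult_mono)
      show "\<bar>\<rho> k\<bar> \<le> (1 / \<delta>) ^ k" unfolding \<rho>_def by (rule gbinomial_double_ratio(2)[OF \<delta>])
      show "\<bar>pcoeff M (2 * k) (off_axis e \<xi>)\<bar> \<le> (2 * (M + 1)) ^ (2 * k)"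
        by (rule abs_pcoeff_le[OF M1 off_axis_bounds[OF ne]])
    qed (use \<epsilon> \<delta> in auto)
    also have "\<dots> = (\<epsilon> / \<delta> * (2 * (M + 1))\<^sup>2) ^ k"
      by (simp only: power_mult power_mult_distrib power_divide) simp
    also have "\<dots> \<le> (1 / 3) ^ k"
      using \<epsilon> \<delta> by (intro power_mono) auto
    finally show ?thesis .
  qed
  \<comment> \<open>The ratio 1/3 makes the terms after the first sum to 1/2 at most, so
    \<open>h\<close> stays within 1/2 of \<open>g 0 = 1\<close> and is positive.\<close>
  have geo: "summable (\<lambda>k. (1 / 3 :: real) ^ k)" "summable (\<lambda>k. (1 / 3 :: real) ^ Suc k)"
    "(\<Sum>k. (1 / 3 :: real) ^ Suc k) = 1 / 2"
    using sums_mult[OF geometric_sums[of "1/3 :: real"], of "1/3"] by (auto simp: sums_iff summable_geometric)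
  have g_summable: "summable (\<lambda>k. g k \<xi>)" for \<xi>
    by (rule summable_comparison_test[OF _ geo(1)]) (use g_le in auto)
  define h where "h \<xi> = (\<Sum>k. g k \<xi>)" for \<xi>
  show "h \<in> borel_measurable borel" unfolding h_def[abs_def] by measurable
  have h1: "\<bar>h \<xi> - 1\<bar> \<le> 1 / 2" for \<xi>
  proof -
    have "h \<xi> - 1 = (\<Sum>k. g (Suc k) \<xi>)"
      using suminf_split_head[OF g_summable, of \<xi>] by (simp add: h_def g0)
    also have "\<bar>\<dots>\<bar> \<le> (\<Sum>k. (1 / 3) ^ Suc k)"
      using norm_suminf_le[OF _ geo(2), of "\<lambda>k. g (Suc k) \<xi>"] g_le by (metis real_norm_def)
    finally show ?thesis using geo(3) by simp
  qed
  show "1 / 2 \<le> h \<xi>" "h \<xi> \<le> 3 / 2" for \<xi>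
    using h1[of \<xi>] unfolding abs_le_iff by linarith+
  fix x :: "real ^ 'n"
  let ?W = "\<lambda>\<xi>. \<bar>x \<bullet> \<xi>\<bar> powr q * student M \<xi>"
  let ?t = "(x \<bullet> e)\<^sup>2 / (norm x)\<^sup>2"
  let ?c = "student_moment M q e * norm x powr q"
  have W: "integrable lborel ?W"
    using integrable_inner_powr_mult_student[of q M "\<lambda>_. 1" 1 x] q M by simp
  have "(\<lambda>k. \<integral>\<xi>. ?W \<xi> * g k \<xi> \<partial>lborel) sums (\<integral>\<xi>. ?W \<xi> * h \<xi> \<partial>lborel)"
    unfolding h_def by (rule sums_integral_mult_bounded[OF W _ g_le geo(1)]) measurable
  also have "(\<lambda>k. \<integral>\<xi>. ?W \<xi> * g k \<xi> \<partial>lborel) = (\<lambda>k. ?c * ((?a gchoose k) * (\<epsilon> * ?t\<^sup>2) ^ k))"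
  proof
    fix k
    have "(\<integral>\<xi>. ?W \<xi> * g k \<xi> \<partial>lborel)
        = \<epsilon> ^ k * \<rho> k * (\<integral>\<xi>. ?W \<xi> * pcoeff M (2 * k) (off_axis e \<xi>) \<partial>lborel)"
      unfolding g_def by (simp add: mult_ac flip: integral_mult_right_zero)
    also have "\<dots> = \<epsilon> ^ k * \<rho> k * (?c * ((?a gchoose (2 * k)) * ?t ^ (2 * k)))"
      by (subst moment_pcoeff[OF e q M]) simp
    also have "\<dots> = ?c * ((?a gchoose k) * (\<epsilon> * ?t\<^sup>2) ^ k)"
      using gbinomial_double_ratio(1)[OF \<delta>, of "2 * k"]
      by (simp add: \<rho>_def power_mult_distrib flip: power_mult)
    finally show "(\<integral>\<xi>. ?W \<xi> * g k \<xi> \<partial>lborel) = ?c * ((?a gchoose k) * (\<epsilon> * ?t\<^sup>2) ^ k)" .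
  qed
  finally have 1: "(\<lambda>k. ?c * ((?a gchoose k) * (\<epsilon> * ?t\<^sup>2) ^ k)) sums (\<integral>\<xi>. ?W \<xi> * h \<xi> \<partial>lborel)" .
  have t: "0 \<le> \<epsilon> * ?t\<^sup>2" "\<epsilon> * ?t\<^sup>2 < 1"
  proof -
    have "?t\<^sup>2 \<le> 1" using axis_ratio_bounds[OF ne, of x] by (intro power_le_one)
    then have "\<epsilon> * ?t\<^sup>2 \<le> \<epsilon> * 1" using \<epsilon> by (intro mult_left_mono) auto
    then show "\<epsilon> * ?t\<^sup>2 < 1" using \<epsilon> by linarith
    show "0 \<le> \<epsilon> * ?t\<^sup>2" using \<epsilon> by simp
  qed
  then have "(\<lambda>k. ?c * ((?a gchoose k) * (\<epsilon> * ?t\<^sup>2) ^ k)) sums (?c * (1 + \<epsilon> * ?t\<^sup>2) powr ?a)"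
    by (intro sums_mult gen_binomial_real) simp
  with 1 have "(\<integral>\<xi>. ?W \<xi> * h \<xi> \<partial>lborel) = ?c * (1 + \<epsilon> * ?t\<^sup>2) powr ?a"
    by (rule sums_unique2)
  also have "(1 + \<epsilon> * ?t\<^sup>2) powr ?a = sqrt (1 + \<epsilon> * ?t\<^sup>2) powr q"
    using t by (simp add: powr_powr flip: powr_half_sqrt)
  also have "?c * sqrt (1 + \<epsilon> * ?t\<^sup>2) powr q = student_moment M q e * quartic_norm \<epsilon> e x powr q"
    using t by (simp add: quartic_norm_def powr_mult)
  finally show "(\<integral>\<xi>. ?W \<xi> * h \<xi> \<partial>lborel) = student_moment M q e * quartic_norm \<epsilon> e x powr q" .
qed

subsection \<open>Subspaces of \<open>L\<^sub>q\<close> from densities\<close>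

text \<open>The embedding sends \<open>x\<close> to the class of
  \<open>\<lambda>t. x \<bullet> V t\<close>, which is linear in \<open>x\<close>.\<close>

lemma isometric_to_subspace_LqI:
  fixes V :: "real \<Rightarrow> 'a::euclidean_space"
  assumes [measurable]: "V \<in> borel_measurable unit_leb"
    and int: "\<And>x. integrable unit_leb (\<lambda>t. \<bar>x \<bullet> V t\<bar> powr q)"
    and N: "\<And>x. (\<integral>t. \<bar>x \<bullet> V t\<bar> powr q \<partial>unit_leb) powr (1 / q) = N x"
  shows "isometric_to_subspace_Lq N q"
proof -
  let ?T = "\<lambda>x. abs_mfun (\<lambda>t. x \<bullet> V t)"
  have eq: "ae_eq (\<lambda>t. x \<bullet> V t) (\<lambda>t. x \<bullet> V t)" for x
    by (simp add: ae_eq_def)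
  have "linear ?T"
    by (rule linearI) (simp_all add: plus_mfun.abs_eq scaleR_mfun.abs_eq eq inner_add_left)
  moreover have "in_Lq q (?T x)" "Lq_norm q (?T x) = N x" for x
    by (simp_all add: in_Lq.abs_eq Lq_norm.abs_eq eq int N)
  ultimately show ?thesis unfolding isometric_to_subspace_Lq_def by blast
qed

text \<open>Normalised, \<open>f\<close> is the density of a probability measure, hence of the law
  of some \<open>V\<close> on the unit interval. A scalar multiple of \<open>V\<close> gives the
  embedding.\<close>

lemma isometric_to_subspace_Lq_density:
  fixes f :: "'a::euclidean_space \<Rightarrow> real"
  assumes q: "0 < q" and c: "0 < c"
    and f: "integrable lborel f" "\<And>\<xi>. 0 < f \<xi>"
    and int: "\<And>x. integrable lborel (\<lambda>\<xi>. \<bar>x \<bullet> \<xi>\<bar> powr q * f \<xi>)"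
    and N: "\<And>x. 0 \<le> N x" "\<And>x. (\<integral>\<xi>. \<bar>x \<bullet> \<xi>\<bar> powr q * f \<xi> \<partial>lborel) = c * N x powr q"
  shows "isometric_to_subspace_Lq N q"
proof -
  have [measurable]: "f \<in> borel_measurable borel" using borel_measurable_integrable[OF f(1)] by simp
  define K where "K = (\<integral>\<xi>. f \<xi> \<partial>lborel)"
  have "K \<noteq> 0"
  proof
    assume "K = 0"
    then have "AE \<xi> in lborel. f \<xi> = 0"
      using integral_nonneg_eq_0_iff_AE[OF f(1)] f(2) by (simp add: K_def less_imp_le)
    then have "AE \<xi>::'a in lborel. False"
      by eventually_elim (metis f(2) less_irrefl)
    then show False by (simp add: eventually_False ae_filter_eq_bot_iff)
  qed
  moreover have "0 \<le> K" unfolding K_def using f(2) by (intro integral_nonneg_AE) (simp add: less_imp_le)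
  ultimately have K: "0 < K" by simp
  define P where "P = density lborel (\<lambda>\<xi>. ennreal (f \<xi> / K))"
  have fK: "0 \<le> f \<xi> / K" for \<xi> using f(2)[of \<xi>] K by (simp add: less_imp_le)
  have "prob_space P"
  proof
    have "emeasure P (space P) = (\<integral>\<^sup>+\<xi>. ennreal (f \<xi> / K) \<partial>lborel)"
      unfolding P_def by (subst emeasure_density) auto
    also have "\<dots> = ennreal (\<integral>\<xi>. f \<xi> / K \<partial>lborel)"
      using f(1) fK by (intro nn_integral_eq_integral) auto
    also have "\<dots> = 1" using K by (simp flip: K_def)
    finally show "emeasure P (space P) = 1" .
  qed
  moreover have "sets P = sets borel" by (simp add: P_def)
  ultimately obtain V where V: "V \<in> borel_measurable borel" "distr unit_leb borel V = P"
    by (rule ex_distr_unit_leb)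
  have VL [measurable]: "V \<in> borel_measurable unit_leb"
    by (rule measurable_restrict_space1) (rule measurable_completion, simp add: V)
  \<comment> \<open>Its power \<open>q\<close> is \<open>K / c\<close>, which undoes the
    normalisation by \<open>K\<close> and removes the constant \<open>c\<close>.\<close>
  let ?l = "(K / c) powr (1 / q)"
  have l: "?l powr q = K / c" using K c q by (simp add: powr_powr)
  have scale: "\<bar>x \<bullet> (?l *\<^sub>R \<xi>)\<bar> powr q = K / c * \<bar>x \<bullet> \<xi>\<bar> powr q" for x \<xi> :: 'a
    using l by (simp add: abs_mult powr_mult)
  have meas: "(\<lambda>\<xi>. \<bar>x \<bullet> \<xi>\<bar> powr q) \<in> borel_measurable borel" for x :: 'a by measurable
  have intP: "integrable P (\<lambda>\<xi>. \<bar>x \<bullet> \<xi>\<bar> powr q)" for x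
    unfolding P_def using fK int[of x]
    by (subst integrable_density) (auto simp: mult.commute)
  have "integrable unit_leb (\<lambda>t. \<bar>x \<bullet> V t\<bar> powr q)" for x
    using intP[of x] unfolding V(2)[symmetric] by (subst (asm) integrable_distr_eq) auto
  then have 1: "integrable unit_leb (\<lambda>t. \<bar>x \<bullet> (?l *\<^sub>R V t)\<bar> powr q)" for x
    unfolding scale by simp
  have 2: "(\<integral>t. \<bar>x \<bullet> (?l *\<^sub>R V t)\<bar> powr q \<partial>unit_leb) powr (1 / q) = N x" for x
  proof -
    have "(\<integral>t. \<bar>x \<bullet> V t\<bar> powr q \<partial>unit_leb) = (\<integral>\<xi>. \<bar>x \<bullet> \<xi>\<bar> powr q \<partial>P)"
      unfolding V(2)[symmetric] by (rule integral_distr[symmetric]) measurable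
    also have "\<dots> = (\<integral>\<xi>. (\<bar>x \<bullet> \<xi>\<bar> powr q * f \<xi>) / K \<partial>lborel)"
      unfolding P_def using fK by (subst integral_density) (auto simp: mult.commute)
    also have "\<dots> = c * N x powr q / K" using N(2) by simp
    finally have "(\<integral>t. \<bar>x \<bullet> (?l *\<^sub>R V t)\<bar> powr q \<partial>unit_leb) = N x powr q"
      unfolding scale using K c by simp
    then show ?thesis using N(1)[of x] q by (simp add: powr_powr)
  qed
  have "(\<lambda>t. ?l *\<^sub>R V t) \<in> borel_measurable unit_leb" by measurable
  then show ?thesis by (rule isometric_to_subspace_LqI[OF _ 1 2])
qed

subsection \<open>The norm\<close>

lemma Lq_norm_1_triangle:
  "in_Lq 1 f \<Longrightarrow> in_Lq 1 g \<Longrightarrow> Lq_norm 1 (f + g) \<le> Lq_norm 1 f + Lq_norm 1 g"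
proof (transfer)
  fix f g :: "real \<Rightarrow> real"
  assume fg: "ae_eq f f" "ae_eq g g"
    and "integrable unit_leb (\<lambda>t. \<bar>f t\<bar> powr 1)" "integrable unit_leb (\<lambda>t. \<bar>g t\<bar> powr 1)"
  then have int: "integrable unit_leb (\<lambda>t. \<bar>f t\<bar>)" "integrable unit_leb (\<lambda>t. \<bar>g t\<bar>)"
    by simp_all
  have [measurable]: "f \<in> borel_measurable unit_leb" "g \<in> borel_measurable unit_leb"
    using fg by (auto simp: ae_eq_def)
  have "integrable unit_leb (\<lambda>t. \<bar>f t + g t\<bar>)"
    by (rule Bochner_Integration.integrable_bound[OF Bochner_Integration.integrable_add[OF int]]) auto
  then have "(\<integral>t. \<bar>f t + g t\<bar> \<partial>unit_leb) \<le> (\<integral>t. \<bar>f t\<bar> + \<bar>g t\<bar> \<partial>unit_leb)"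
    using int by (intro integral_mono) auto
  also have "\<dots> = (\<integral>t. \<bar>f t\<bar> \<partial>unit_leb) + (\<integral>t. \<bar>g t\<bar> \<partial>unit_leb)"
    using int by simp
  finally show "(\<integral>t. \<bar>f t + g t\<bar> powr 1 \<partial>unit_leb) powr (1 / 1)
      \<le> (\<integral>t. \<bar>f t\<bar> powr 1 \<partial>unit_leb) powr (1 / 1) + (\<integral>t. \<bar>g t\<bar> powr 1 \<partial>unit_leb) powr (1 / 1)"
    by (simp add: integral_nonneg_AE)
qed

text \<open>The triangle inequality is pulled back along the linear isometry;
  \<open>quartic_norm\<close> acquires its own in this way.\<close>

lemma isometric_to_subspace_L1_triangle:
  assumes "isometric_to_subspace_Lq N 1"
  shows "N (x + y) \<le> N x + N y"
proof -
  obtain T where T: "linear T" "\<And>x. in_Lq 1 (T x)" "\<And>x. Lq_norm 1 (T x) = N x"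
    using assms unfolding isometric_to_subspace_Lq_def by blast
  then show ?thesis
    using Lq_norm_1_triangle[OF T(2) T(2), of x y] by (simp add: linear_add[OF T(1), symmetric])
qed

text \<open>Equivalent norms: the lower bound makes an \<open>N\<close>-Cauchy sequence Cauchy for
  \<open>norm\<close>, and the upper bound turns its limit into a limit for
  \<open>N\<close>.\<close>

lemma is_banach_normI:
  fixes N :: "'a::banach \<Rightarrow> real"
  assumes N: "is_norm N" and le: "\<And>x. norm x \<le> N x" "\<And>x. N x \<le> C * norm x"
  shows "is_banach_norm N"
proof -
  have N0: "N 0 = 0" and Npos: "\<And>x. 0 \<le> N x" "\<And>x. N x = 0 \<longleftrightarrow> x = 0"
    and Nscale: "\<And>c x. N (c *\<^sub>R x) = \<bar>c\<bar> * N x" and Nadd: "\<And>x y. N (x + y) \<le> N x + N y"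
    using N unfolding is_norm_def by blast+
  have Nminus: "N (x - y) = N (y - x)" for x y
    using Nscale[of "-1" "y - x"] by simp
  interpret Metric_space UNIV "\<lambda>x y. N (x - y)"
  proof
    show "N (x - z) \<le> N (x - y) + N (y - z)" for x y z
      using Nadd[of "x - y" "y - z"] by simp
  qed (use Npos Nminus in auto)
  have "mcomplete"
    unfolding mcomplete_def
  proof (intro allI impI)
    fix \<sigma> assume "MCauchy \<sigma>"
    then have \<sigma>: "\<forall>\<epsilon>>0. \<exists>K. \<forall>n n'. K \<le> n \<longrightarrow> K \<le> n' \<longrightarrow> N (\<sigma> n - \<sigma> n') < \<epsilon>"
      by (simp add: MCauchy_def)
    have "Cauchy \<sigma>"
      unfolding Cauchy_def dist_norm using \<sigma> le(1) by (meson le_less_trans)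
    then obtain x where x: "\<sigma> \<longlonglongrightarrow> x"
      using Cauchy_convergent convergentD by blast
    have "(\<lambda>n. N (\<sigma> n - x)) \<longlonglongrightarrow> 0"
    proof (rule tendsto_sandwich[of "\<lambda>_. 0"])
      show "(\<lambda>n. C * norm (\<sigma> n - x)) \<longlonglongrightarrow> 0"
        using x by (auto intro!: tendsto_mult_right_zero tendsto_norm_zero simp: LIM_zero_iff)
    qed (use Npos le in auto)
    then have "limitin mtopology \<sigma> x sequentially"
      by (simp add: limit_metric_sequentially LIMSEQ_iff Npos)
    then show "\<exists>x. limitin mtopology \<sigma> x sequentially" ..
  qed
  with N show ?thesis by (simp add: is_banach_norm_def)
qed

lemma quartic_norm_bounds:
  fixes x e :: "'a::euclidean_space"
  assumes e: "norm e = 1" and \<epsilon>: "0 < \<epsilon>" "\<epsilon> < 1"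
  shows "norm x \<le> quartic_norm \<epsilon> e x" "quartic_norm \<epsilon> e x \<le> 2 * norm x"
proof -
  let ?t = "(x \<bullet> e)\<^sup>2 / (norm x)\<^sup>2"
  have "?t\<^sup>2 \<le> 1" using axis_ratio_bounds[OF e, of x] by (intro power_le_one)
  then have "\<epsilon> * ?t\<^sup>2 \<le> 1 * 1" using \<epsilon> by (intro mult_mono) auto
  then have "sqrt (1 + \<epsilon> * ?t\<^sup>2) \<le> 2" by (intro real_le_lsqrt) auto
  moreover have "1 \<le> sqrt (1 + \<epsilon> * ?t\<^sup>2)" using \<epsilon> by simp
  ultimately show "norm x \<le> quartic_norm \<epsilon> e x" "quartic_norm \<epsilon> e x \<le> 2 * norm x"
    unfolding quartic_norm_def by (auto simp: mult_le_cancel_left1 mult.commute intro: mult_left_mono)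
qed

lemma quartic_norm_scaleR: "quartic_norm \<epsilon> e (c *\<^sub>R x) = \<bar>c\<bar> * quartic_norm \<epsilon> e x"
  by (cases "c = 0") (simp_all add: quartic_norm_def power_mult_distrib)

text \<open>The parallelogram law fails at \<open>e\<close> and \<open>f\<close>: the squares for
  \<open>e + f\<close> and \<open>e - f\<close> add up to \<open>4 + \<epsilon>\<close>, while twice
  those for \<open>e\<close> and \<open>f\<close> give \<open>4 + 2 * \<epsilon>\<close>.\<close>

lemma not_is_hilbert_norm_quartic:
  fixes e f :: "'a::euclidean_space"
  assumes e: "e \<in> Basis" "f \<in> Basis" "e \<noteq> f" and \<epsilon>: "0 < \<epsilon>"
  shows "\<not> is_hilbert_norm (quartic_norm \<epsilon> e)"
proof
  assume "is_hilbert_norm (quartic_norm \<epsilon> e)"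
  then obtain B where B: "is_inner_product B" and NB: "\<And>x. quartic_norm \<epsilon> e x = sqrt (B x x)"
    unfolding is_hilbert_norm_def by blast
  have bil: "bilinear B" and pos: "\<And>x. x \<noteq> 0 \<Longrightarrow> 0 < B x x"
    using B unfolding is_inner_product_def by blast+
  have "0 \<le> B x x" for x
    using pos[of x] bilinear_lzero[OF bil, of 0] by (cases "x = 0") auto
  then have sq: "(quartic_norm \<epsilon> e x)\<^sup>2 = B x x" for x by (simp add: NB)
  have par: "B (e + f) (e + f) + B (e - f) (e - f) = 2 * B e e + 2 * B f f"
    by (simp add: bilinear_ladd[OF bil] bilinear_radd[OF bil] bilinear_lsub[OF bil] bilinear_rsub[OF bil])
  have in1: "e \<bullet> e = 1" "f \<bullet> f = 1" "e \<bullet> f = 0" "f \<bullet> e = 0"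
    using e by (auto simp: inner_Basis)
  have N2: "(quartic_norm \<epsilon> e x)\<^sup>2 = (x \<bullet> x) * (1 + \<epsilon> * ((x \<bullet> e)\<^sup>2 / (x \<bullet> x))\<^sup>2)" for x
    using \<epsilon> by (simp add: quartic_norm_def power_mult_distrib power2_norm_eq_inner)
  have "B e e = 1 + \<epsilon>" "B f f = 1" "B (e + f) (e + f) = 2 + \<epsilon> / 2" "B (e - f) (e - f) = 2 + \<epsilon> / 2"
    unfolding sq[symmetric] N2
    by (simp_all add: inner_add_left inner_add_right inner_diff_left inner_diff_right in1 power2_eq_square field_simps)
  with par \<epsilon> show False by simp
qed

text \<open>For \<open>j\<close> up to \<open>R\<close>, the gap comes from the positive distance
  between the compact set of all \<open>q / 2\<close> and the closed set of naturals. For larger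
  \<open>j\<close>, the difference exceeds \<open>j / 2\<close> and so grows linearly.\<close>

lemma compact_even_gap:
  fixes Q :: "real set"
  assumes "compact Q" and Q: "Q \<subseteq> {0<..} - {2 * real k | k. k \<ge> 1}"
  obtains \<delta> R where "0 < \<delta>" "\<And>q. q \<in> Q \<Longrightarrow> q \<le> R"
    "\<And>q j. q \<in> Q \<Longrightarrow> \<delta> * (real j + 1) \<le> \<bar>q / 2 - real j\<bar>"
proof -
  obtain R0 where R0: "\<And>q. q \<in> Q \<Longrightarrow> \<bar>q\<bar> \<le> R0"
    using compact_imp_bounded[OF \<open>compact Q\<close>] by (auto simp: bounded_iff)
  define R where "R = max 1 R0"
  have R: "1 \<le> R" "q \<in> Q \<Longrightarrow> q \<le> R" for q using R0[of q] by (auto simp: R_def)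
  have "compact ((\<lambda>q. q / 2) ` Q)"
    using \<open>compact Q\<close> by (intro compact_continuous_image continuous_intros) auto
  moreover have "closed (range (of_nat :: nat \<Rightarrow> real))"
    by (rule closed_of_nat_image)
  moreover have "(\<lambda>q. q / 2) ` Q \<inter> range of_nat = {}"
  proof -
    have False if "q \<in> Q" "q / 2 = real k" for q k
    \<comment> \<open>The excluded even integers start at 2; the natural number 0 is ruled out by
      \<open>q > 0\<close>.\<close>
    proof (cases "k = 0")
      case True
      then show False using that Q by auto
    next
      case False
      moreover have "q = 2 * real k" using that by simp
      ultimately show False using that(1) Q by fastforce
    qed
    then show ?thesis by blast
  qed
  ultimately obtain d where d: "0 < d" "\<And>q j. q \<in> Q \<Longrightarrow> d \<le> dist (q / 2) (real j)"
    by (metis separate_compact_closed imageI rangeI)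
  \<comment> \<open>The first bound is for \<open>j > R\<close>, where \<open>R \<ge> 1\<close>
    gives \<open>j + 1 \<le> 2 * j\<close>; the second is for \<open>j \<le> R\<close>.\<close>
  define \<delta> where "\<delta> = min (1 / 4) (d / (R + 1))"
  have \<delta>: "0 < \<delta>" "\<delta> \<le> 1 / 4" "\<delta> * (R + 1) \<le> d"
  proof -
    show "0 < \<delta>" using d(1) R(1) by (simp add: \<delta>_def)
    show "\<delta> \<le> 1 / 4" unfolding \<delta>_def by (rule min.cobounded1)
    have "\<delta> \<le> d / (R + 1)" by (simp add: \<delta>_def)
    then show "\<delta> * (R + 1) \<le> d" using R(1) by (simp add: le_divide_eq)
  qed
  show thesis
  proof
    fix q j assume q: "q \<in> Q"
    show "\<delta> * (real j + 1) \<le> \<bar>q / 2 - real j\<bar>"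
    proof (cases "real j \<le> R")
      case True
      then have "\<delta> * (real j + 1) \<le> \<delta> * (R + 1)" using \<delta>(1) by (intro mult_left_mono) auto
      then show ?thesis using \<delta>(3) d(2)[OF q, of j] by (simp add: dist_real_def)
    next
      case False
      then have "\<delta> * (real j + 1) \<le> 1 / 4 * (real j + 1)" using \<delta> by (intro mult_right_mono) auto
      also have "\<dots> \<le> real j - q / 2" using False R(1) R(2)[OF q] by simp
      finally show ?thesis by simp
    qed
  qed (use \<delta> R in auto)
qed

section \<open>Embedding the norm, with constants uniform in the exponent\<close>

lemma isometric_quartic_norm:
  fixes e :: "real ^ 'n"
  assumes e: "e \<in> Basis" and q: "0 < q" and M: "CARD('n) + q / 2 \<le> M"
    and \<delta>: "0 < \<delta>" "\<And>j::nat. \<delta> * (real j + 1) \<le> \<bar>q / 2 - real j\<bar>"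
    and \<epsilon>: "0 < \<epsilon>" "\<epsilon> < 1" "\<epsilon> / \<delta> * (2 * (M + 1))\<^sup>2 \<le> 1 / 3"
  shows "isometric_to_subspace_Lq (quartic_norm \<epsilon> e) q"
proof -
  obtain h where h [measurable]: "h \<in> borel_measurable borel" and hb: "\<And>\<xi>. 1 / 2 \<le> h \<xi>" "\<And>\<xi>. h \<xi> \<le> 3 / 2"
    and hN: "\<And>x. (\<integral>\<xi>. \<bar>x \<bullet> \<xi>\<bar> powr q * student M \<xi> * h \<xi> \<partial>lborel) = student_moment M q e * quartic_norm \<epsilon> e x powr q"
    using ex_weight[OF assms] by blast
  have h_abs: "\<bar>h \<xi>\<bar> \<le> 3 / 2" for \<xi> using hb[of \<xi>] by simp
  have M': "DIM(real ^ 'n) + q / 2 \<le> M" using M by simp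
  show ?thesis
  proof (rule isometric_to_subspace_Lq_density[OF q, where f = "\<lambda>\<xi>. student M \<xi> * h \<xi>"])
    show "0 < student_moment M q e" using e by (intro student_moment_pos[OF q M']) auto
    show "integrable lborel (\<lambda>\<xi>. student M \<xi> * h \<xi>)"
    proof (rule integrable_student_mult[OF _ h h_abs])
      show "real DIM(real ^ 'n) \<le> M" using M' q by linarith
    qed
    show "0 < student M \<xi> * h \<xi>" for \<xi>
      using hb(1)[of \<xi>] by (intro mult_pos_pos student_pos) simp
    show "integrable lborel (\<lambda>\<xi>. \<bar>x \<bullet> \<xi>\<bar> powr q * (student M \<xi> * h \<xi>))" for x
      using integrable_inner_powr_mult_student[OF q M' h h_abs] by (simp add: mult.assoc)
    show "0 \<le> quartic_norm \<epsilon> e x" for x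
      using order_trans[OF norm_ge_zero quartic_norm_bounds(1)[OF norm_Basis[OF e] \<epsilon>(1,2)]] .
    show "(\<integral>\<xi>. \<bar>x \<bullet> \<xi>\<bar> powr q * (student M \<xi> * h \<xi>) \<partial>lborel)
        = student_moment M q e * quartic_norm \<epsilon> e x powr q" for x
      using hN[of x] by (simp add: mult.assoc)
  qed
qed

theorem theorem2:
  fixes Q :: "real set"
  assumes "CARD('n::finite) \<ge> 2"
    and "compact Q"
    and "Q \<subseteq> {0<..} - {2 * real k | k. k \<ge> 1}"
  shows "\<exists>N :: real ^ 'n \<Rightarrow> real.
    is_banach_norm N \<and> \<not> is_hilbert_norm N \<and>
    (\<forall>q\<in>Q. isometric_to_subspace_Lq N q)"
proof -
  have "\<exists>i j :: 'n. i \<noteq> j"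
    using assms(1) by (metis (full_types) UNIV_I card_2_iff' card_le_Suc0_iff_eq finite not_less_eq_eq numeral_2_eq_2)
  then obtain i j :: 'n where ij: "i \<noteq> j" by blast
  define e f :: "real ^ 'n" where "e = axis i 1" and "f = axis j 1"
  have ef: "e \<in> Basis" "f \<in> Basis" "e \<noteq> f"
    using ij by (auto simp: e_def f_def axis_in_Basis_iff axis_eq_axis)
  have ne: "norm e = 1" using ef by simp
  \<comment> \<open>The exponent 1 is not even and may be added; the resulting embedding into
    \<open>L\<^sub>1\<close> yields the triangle inequality.\<close>
  have "compact (insert 1 Q)" using assms(2) by (rule compact_insert)
  moreover have "insert 1 Q \<subseteq> {0<..} - {2 * real k | k. k \<ge> 1}"
  proof -
    have "2 * real k \<noteq> 1" for k
    proof
      assume "2 * real k = 1"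
      then have "real (2 * k) = real 1" by simp
      then show False unfolding of_nat_eq_iff by presburger
    qed
    then show ?thesis using assms(3) by fastforce
  qed
  ultimately obtain \<delta> R where \<delta>: "0 < \<delta>" and R: "\<And>q. q \<in> insert 1 Q \<Longrightarrow> q \<le> R"
    and gap: "\<And>q j. q \<in> insert 1 Q \<Longrightarrow> \<delta> * (real j + 1) \<le> \<bar>q / 2 - real j\<bar>"
    by (rule compact_even_gap) (use that in blast)
  \<comment> \<open>A single weight exponent for all \<open>q\<close>, using the bound
    \<open>R\<close>.\<close>
  define M where "M = CARD('n) + R / 2"
  have "1 \<le> R" using R by simp
  then have "0 < M" by (simp add: M_def add_nonneg_pos)
  \<comment> \<open>Depends only on \<open>\<delta>\<close> and \<open>M\<close>, so one norm serves
    every exponent; the second bound is the smallness required by \<open>ex_weight\<close>.\<close>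
  define \<epsilon> where "\<epsilon> = min (1 / 2) (\<delta> / (3 * (2 * (M + 1))\<^sup>2))"
  have \<epsilon>: "0 < \<epsilon>" "\<epsilon> < 1" using \<delta> \<open>0 < M\<close> by (auto simp: \<epsilon>_def)
  have "\<epsilon> \<le> \<delta> / (3 * (2 * (M + 1))\<^sup>2)" by (simp add: \<epsilon>_def)
  then have \<epsilon>3: "\<epsilon> / \<delta> * (2 * (M + 1))\<^sup>2 \<le> 1 / 3"
    using \<delta> \<open>0 < M\<close> by (simp add: field_simps)
  let ?N = "quartic_norm \<epsilon> e"
  have iso: "isometric_to_subspace_Lq ?N q" if "q \<in> insert 1 Q" for q
  proof (rule isometric_quartic_norm[OF ef(1) _ _ \<delta> gap[OF that] \<epsilon> \<epsilon>3])
    show "0 < q" using that assms(3) by auto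
    show "CARD('n) + q / 2 \<le> M" using R[OF that] by (simp add: M_def)
  qed
  have "is_norm ?N"
    unfolding is_norm_def
  proof (intro conjI allI)
    fix x y c
    show "0 \<le> ?N x" using quartic_norm_bounds(1)[OF ne \<epsilon>, of x] norm_ge_zero[of x] by linarith
    show "?N x = 0 \<longleftrightarrow> x = 0" using quartic_norm_bounds[OF ne \<epsilon>, of x] by auto
    show "?N (c *\<^sub>R x) = \<bar>c\<bar> * ?N x" by (rule quartic_norm_scaleR)
    show "?N (x + y) \<le> ?N x + ?N y" by (rule isometric_to_subspace_L1_triangle) (simp add: iso)
  qed
  then have "is_banach_norm ?N"
    using quartic_norm_bounds[OF ne \<epsilon>] by (rule is_banach_normI)
  moreover have "\<not> is_hilbert_norm ?N" by (rule not_is_hilbert_norm_quartic[OF ef \<epsilon>(1)])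
  ultimately show ?thesis using iso by blast
qed

end
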